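(* Let $n\ge 1$ and let $\varepsilon\mapsto A(\varepsilon)$ be a $C^\infty$ family, defined for real $\varepsilon$ in a neighbourhood of $0$, of $n\times n$ real symmetric (respectively complex Hermitian) matrices. Then, for $\varepsilon$ in a neighbourhood of $0$, there exist a $C^\infty$ family of orthogonal (respectively unitary) matrices $U(\varepsilon)$ and $C^\infty$ functions $\varepsilon\mapsto\lambda_{j,\varepsilon}\in\mathbb{R}$, $j=1,\dots,n$, such that $$U^{-1}(\varepsilon)A(\varepsilon)U(\varepsilon)=\mathrm{diag}(\lambda_{1,\varepsilon},\dots,\lambda_{n,\varepsilon})+\mathcal{O}(\varepsilon^\infty).$$
   Context: $\mathcal{O}(\varepsilon^\infty)$ denotes a (matrix-valued) function of $\varepsilon$ which is $\mathcal{O}(\varepsilon^N)$ as $\varepsilon\to0$ for every $N\in\mathbb{N}$. *)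

theory Defs
  imports "HOL-Analysis.Analysis" "HOL-Library.Landau_Symbols"
begin

definition iterated_vector_derivative ::
    "nat \<Rightarrow> (real \<Rightarrow> 'a::real_normed_vector) \<Rightarrow> real \<Rightarrow> 'a" where
  "iterated_vector_derivative k f = ((\<lambda>g t. vector_derivative g (at t)) ^^ k) f"

text \<open>
  The class \<open>C\<^sup>\<infinity>\<close> on \<open>S\<close>, intended for open \<open>S\<close>. Continuity of the \<open>k\<close>-th derivative on \<open>S\<close>
  is part of its differentiability.
\<close>
definition C_infinity_on :: "real set \<Rightarrow> (real \<Rightarrow> 'a::real_normed_vector) \<Rightarrow> bool" where
  "C_infinity_on S f \<longleftrightarrow> (\<forall>k. \<forall>t\<in>S. iterated_vector_derivative k f differentiable (at t))"

definition symmetric_matrix :: "real^'n^'n \<Rightarrow> bool" where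
  "symmetric_matrix A \<longleftrightarrow> transpose A = A"

definition conjugate_transpose :: "complex^'n^'m \<Rightarrow> complex^'m^'n" where
  "conjugate_transpose A = (\<chi> i j. cnj (A $ j $ i))"

definition hermitian_matrix :: "complex^'n^'n \<Rightarrow> bool" where
  "hermitian_matrix A \<longleftrightarrow> conjugate_transpose A = A"

definition unitary_matrix :: "complex^'n^'n \<Rightarrow> bool" where
  "unitary_matrix U \<longleftrightarrow> conjugate_transpose U ** U = mat 1 \<and> U ** conjugate_transpose U = mat 1"

definition diagonal_matrix :: "('n \<Rightarrow> 'a::zero) \<Rightarrow> 'a^'n^'n" where
  "diagonal_matrix d = (\<chi> i j. if i = j then d i else 0)"

text \<open>
  The Landau symbols of the library only apply to functions with values in a normed field,
  hence the norm. The filter \<open>nhds 0\<close> includes the point \<open>0\<close> itself.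
\<close>
definition is_O_eps_infinity :: "(real \<Rightarrow> 'a::real_normed_vector) \<Rightarrow> bool" where
  "is_O_eps_infinity R \<longleftrightarrow> (\<forall>N::nat. (\<lambda>\<epsilon>. norm (R \<epsilon>)) \<in> O[nhds 0](\<lambda>\<epsilon>. \<epsilon> ^ N))"

end

theory Submission
  imports Defs
begin

text \<open>
  Among all smooth unitary families \<open>U\<close> and partitions of the index set for which \<open>U\<^sup>* A U\<close> is exactly
  block diagonal near \<open>0\<close>, choose one with the maximal number of blocks. Subtract from each block its mean
  diagonal entry; the claim is that the remainder \<open>N\<close> is flat at \<open>0\<close>. Otherwise \<open>N = \<epsilon>\<^sup>k B\<close> with \<open>B\<close>
  smooth and \<open>B(0) \<noteq> 0\<close> of mean zero on each block, so some block of \<open>B(0)\<close> has eigenvalues on both sides of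
  a number \<open>c\<close> outside the spectrum. The sign \<open>J = (B - c) ((B - c)\<^sup>2)\<^sup>-\<^sup>1\<^sup>/\<^sup>2\<close> is smooth, and a smooth unitary
  family conjugating \<open>J\<close> to \<open>J(0)\<close> splits that block, contradicting maximality.

  The square root \<open>T\<close> of a smooth positive definite family \<open>H\<close> is smooth because its derivative solves the
  Sylvester equation \<open>T X + X T = H'\<close>, whose solution operator is bounded when \<open>T\<close> is bounded below.

  The real case is treated inside the complex one: a flag \<open>b\<close> requires all matrices involved to be fixed by
  entrywise conjugation.
\<close>

section \<open>Smooth functions of a real variable\<close>

text \<open>The obstacle is that eigenvectors of a smooth Hermitian family need not have a smooth
  choice: eigenvalues may meet infinitely often near 0 while the eigenframe keeps turning, which is
  why a flat remainder appears. No eigenvalue is therefore followed along the family. Spectra are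
  used only at the parameter 0, where a gap is a plain inequality between finitely many numbers and
  survives nearby by continuity. The block mean is the right substitute for an eigenvalue: it is
  linear in the matrix, hence smooth, and it is constant on blocks, hence the diagonal matrix of
  means commutes with every block diagonal matrix. So whatever splits \<open>B\<close> splits the
  whole family, and dividing by a power of the parameter loses nothing. Taking a maximal partition
  replaces an iterated splitting, bounded because there are at most n blocks. The sign and the
  unitary conjugation need only inverse square roots. Sylvester equations supply their smoothness,
  and uniqueness of solutions supplies their commutation properties without a functional
  calculus.\<close>

primrec Ck_on :: "nat \<Rightarrow> real set \<Rightarrow> (real \<Rightarrow> 'a::real_normed_vector) \<Rightarrow> bool" where
  "Ck_on 0 V f \<longleftrightarrow> continuous_on V f"
| "Ck_on (Suc k) V f \<longleftrightarrow> (\<exists>g. (\<forall>t\<in>V. (f has_vector_derivative g t) (at t)) \<and> Ck_on k V g)"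

lemma Ck_on_cong:
  assumes "open V" "\<And>t. t \<in> V \<Longrightarrow> f t = g t" "Ck_on k V f"
  shows "Ck_on k V g"
proof (cases k)
  case 0
  with assms show ?thesis by (metis Ck_on.simps(1) continuous_on_cong)
next
  case (Suc m)
  with assms(3) obtain h where h: "\<forall>t\<in>V. (f has_vector_derivative h t) (at t)" "Ck_on m V h" by auto
  have "(g has_vector_derivative h t) (at t)" if "t \<in> V" for t
    using has_vector_derivative_transform_within_open[of f "h t" t V g] h that assms by auto
  with h Suc show ?thesis by auto
qed

lemma Ck_on_imp_continuous_on: "Ck_on k V f \<Longrightarrow> continuous_on V f"
  by (cases k)
     (auto intro!: continuous_at_imp_continuous_on intro: has_vector_derivative_continuous)

lemma Ck_on_Suc_imp: "Ck_on (Suc k) V f \<Longrightarrow> Ck_on k V f"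
proof (induction k arbitrary: f)
  case 0
  show ?case using Ck_on_imp_continuous_on[OF 0] by simp
next
  case (Suc k)
  from Suc.prems obtain g where "\<forall>t\<in>V. (f has_vector_derivative g t) (at t)" "Ck_on (Suc k) V g"
    unfolding Ck_on.simps(2)[of "Suc k"] by blast
  with Suc.IH show ?case by auto
qed

lemma Ck_on_subset: "Ck_on k V f \<Longrightarrow> W \<subseteq> V \<Longrightarrow> Ck_on k W f"
  by (induction k arbitrary: f) (auto intro: continuous_on_subset)

lemma Ck_on_const: "Ck_on k V (\<lambda>_. c)"
  by (induction k arbitrary: c) (auto intro!: exI[of _ "\<lambda>_. 0"])

lemma Ck_on_add:
  "Ck_on k V f \<Longrightarrow> Ck_on k V g \<Longrightarrow> Ck_on k V (\<lambda>t. f t + g t)"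
proof (induction k arbitrary: f g)
  case (Suc k)
  then obtain f' g' where
    "\<forall>t\<in>V. (f has_vector_derivative f' t) (at t)" "Ck_on k V f'"
    "\<forall>t\<in>V. (g has_vector_derivative g' t) (at t)" "Ck_on k V g'" by auto
  with Suc.IH show ?case
    by (auto intro!: exI[of _ "\<lambda>t. f' t + g' t"] has_vector_derivative_add)
qed (auto intro: continuous_on_add)

lemma (in bounded_linear) Ck_on: "Ck_on k V g \<Longrightarrow> Ck_on k V (\<lambda>t. f (g t))"
proof (induction k arbitrary: g)
  case (Suc k)
  then obtain g' where
    "\<forall>t\<in>V. (g has_vector_derivative g' t) (at t)" "Ck_on k V g'" by auto
  with Suc.IH show ?case
    by (auto intro!: exI[of _ "\<lambda>t. f (g' t)"] has_vector_derivative)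
qed (auto intro: continuous_on)

lemma Ck_on_bilinear:
  assumes "bounded_bilinear h"
  shows "Ck_on k V f \<Longrightarrow> Ck_on k V g \<Longrightarrow> Ck_on k V (\<lambda>t. h (f t) (g t))"
proof (induction k arbitrary: f g)
  case (Suc k)
  then obtain f' g' where *:
    "\<forall>t\<in>V. (f has_vector_derivative f' t) (at t)" "Ck_on k V f'"
    "\<forall>t\<in>V. (g has_vector_derivative g' t) (at t)" "Ck_on k V g'" by auto
  have "Ck_on k V (\<lambda>t. h (f t) (g' t) + h (f' t) (g t))"
    by (rule Ck_on_add[OF Suc.IH[OF Ck_on_Suc_imp[OF Suc.prems(1)] *(4)]
          Suc.IH[OF *(2) Ck_on_Suc_imp[OF Suc.prems(2)]]])
  moreover have "\<forall>t\<in>V. ((\<lambda>t. h (f t) (g t)) has_vector_derivative h (f t) (g' t) + h (f' t) (g t)) (at t)"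
    using * by (auto intro: bounded_bilinear.has_vector_derivative[OF assms])
  ultimately show ?case
    unfolding Ck_on.simps(2) by (intro exI[of _ "\<lambda>t. h (f t) (g' t) + h (f' t) (g t)"] conjI)
qed (simp add: bounded_bilinear.continuous_on[OF assms])

text \<open>In \<open>Ck_on\<close> the derivative is an existential witness instead of
  \<open>vector_derivative\<close>. Closure under sums, linear maps and products is then a direct
  induction that exhibits the derivative, and \<open>C_infinity_on\<close> is needed only at the two
  ends of the argument.\<close>

definition smooth_on :: "real set \<Rightarrow> (real \<Rightarrow> 'a::real_normed_vector) \<Rightarrow> bool" where
  "smooth_on V f \<longleftrightarrow> (\<forall>k. Ck_on k V f)"

lemma iterated_vector_derivative_0: "iterated_vector_derivative 0 f = f"
  by (simp add: iterated_vector_derivative_def)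

lemma iterated_vector_derivative_Suc:
  "iterated_vector_derivative (Suc k) f t = vector_derivative (iterated_vector_derivative k f) (at t)"
  by (simp add: iterated_vector_derivative_def)

lemma iterated_vector_derivative_Suc2:
  "iterated_vector_derivative (Suc k) f = iterated_vector_derivative k (\<lambda>t. vector_derivative f (at t))"
  by (simp add: iterated_vector_derivative_def funpow_Suc_right del: funpow.simps)

lemma iterated_vector_derivative_cong:
  assumes "open V" "\<And>t. t \<in> V \<Longrightarrow> f t = g t" "t \<in> V"
  shows "iterated_vector_derivative k f t = iterated_vector_derivative k g t"
  using assms(3)
proof (induction k arbitrary: t)
  case (Suc k)
  have "\<forall>\<^sub>F s in nhds t. s \<in> V" using assms(1) Suc.prems by (rule eventually_nhds_in_open)
  then have "\<forall>\<^sub>F s in nhds t. iterated_vector_derivative k f s = iterated_vector_derivative k g s"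
    by eventually_elim (rule Suc.IH)
  then show ?case
    unfolding iterated_vector_derivative_Suc by (intro vector_derivative_cong_eq) (auto simp: Suc.prems)
qed (simp add: assms iterated_vector_derivative_0)

lemma C_infinity_on_iff_smooth_on:
  assumes "open V"
  shows "C_infinity_on V f \<longleftrightarrow> smooth_on V f"
proof
  assume f: "C_infinity_on V f"
  have D: "(iterated_vector_derivative k f has_vector_derivative iterated_vector_derivative (Suc k) f t) (at t)"
    if "t \<in> V" for k t
    using f that by (simp add: C_infinity_on_def iterated_vector_derivative_Suc vector_derivative_works)
  have "Ck_on k V (iterated_vector_derivative m f)" for k m
  proof (induction k arbitrary: m)
    case 0
    show ?case using D
      by (auto intro!: continuous_at_imp_continuous_on has_vector_derivative_continuous)
  next
    case (Suc k)
    then show ?case using D by (auto intro!: exI[of _ "iterated_vector_derivative (Suc m) f"])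
  qed
  from this[of _ 0] show "smooth_on V f" by (simp add: smooth_on_def iterated_vector_derivative_0)
next
  assume f: "smooth_on V f"
  have "iterated_vector_derivative k f differentiable (at t)" if "t \<in> V" "Ck_on (Suc k) V f" for k t
    using that(2)
  proof (induction k arbitrary: f)
    case 0
    then show ?case using that(1) by (auto simp: iterated_vector_derivative_0 intro: differentiableI_vector)
  next
    case (Suc k)
    from Suc.prems obtain g where g: "\<forall>t\<in>V. (f has_vector_derivative g t) (at t)" "Ck_on (Suc k) V g"
      unfolding Ck_on.simps(2)[of "Suc k"] by blast
    have eq: "g t = vector_derivative f (at t)" if "t \<in> V" for t
      using vector_derivative_at g(1) that by metis
    have "iterated_vector_derivative k g differentiable (at t)" by (rule Suc.IH[OF g(2)])
    then obtain D where "(iterated_vector_derivative k g has_derivative D) (at t)"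
      unfolding differentiable_def by blast
    \<comment> \<open>The witness \<open>g\<close> equals the derivative of \<open>f\<close> only on
      \<open>V\<close>; openness of \<open>V\<close> makes this agreement hold near
      \<open>t\<close>, so iterated derivatives agree there too.\<close>
    then have "(iterated_vector_derivative (Suc k) f has_derivative D) (at t)"
      unfolding iterated_vector_derivative_Suc2
      by (rule has_derivative_transform_within_open[OF _ assms \<open>t \<in> V\<close>])
         (rule iterated_vector_derivative_cong[OF assms eq])
    then show ?case by (rule differentiableI)
  qed
  then show "C_infinity_on V f" using f unfolding C_infinity_on_def smooth_on_def by blast
qed

lemma smooth_on_subset: "smooth_on V f \<Longrightarrow> W \<subseteq> V \<Longrightarrow> smooth_on W f"
  unfolding smooth_on_def using Ck_on_subset by blast

lemma smooth_on_const: "smooth_on V (\<lambda>_. c)"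
  by (simp add: smooth_on_def Ck_on_const)

lemma smooth_on_imp_continuous_on: "smooth_on V f \<Longrightarrow> continuous_on V f"
  unfolding smooth_on_def using Ck_on_imp_continuous_on by blast

lemma smooth_on_add: "smooth_on V f \<Longrightarrow> smooth_on V g \<Longrightarrow> smooth_on V (\<lambda>t. f t + g t)"
  by (simp add: smooth_on_def Ck_on_add)

lemma (in bounded_linear) smooth_on: "smooth_on V g \<Longrightarrow> smooth_on V (\<lambda>t. f (g t))"
  by (simp add: smooth_on_def Ck_on)

lemma smooth_on_diff: "smooth_on V f \<Longrightarrow> smooth_on V g \<Longrightarrow> smooth_on V (\<lambda>t. f t - g t)"
  using smooth_on_add[of V f "\<lambda>t. - g t"]
    bounded_linear.smooth_on[OF bounded_linear_minus[OF bounded_linear_ident], of V g] by simp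

lemma smooth_on_scaleR: "smooth_on V f \<Longrightarrow> smooth_on V (\<lambda>t. c *\<^sub>R f t)"
  by (rule bounded_linear.smooth_on[OF bounded_linear_scaleR_right])

lemma smooth_on_bilinear:
  assumes "bounded_bilinear h" "smooth_on V f" "smooth_on V g"
  shows "smooth_on V (\<lambda>t. h (f t) (g t))"
  using Ck_on_bilinear[OF assms(1), of _ V f g] assms(2,3) by (simp add: smooth_on_def)

text \<open>The quotient is the integral of f'(ts) over s in [0,1], which is defined and smooth at t
  = 0 as well. The radius does not shrink, so the division can be repeated any number of times on
  one ball.\<close>

lemma Hadamard_division:
  fixes f :: "real \<Rightarrow> 'a::euclidean_space"
  assumes "smooth_on (ball 0 r) f" "f 0 = 0" "r > 0"
  obtains g where "smooth_on (ball 0 r) g" "\<And>t. t \<in> ball 0 r \<Longrightarrow> f t = t *\<^sub>R g t"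
proof -
  \<comment> \<open>Differentiating under the integral sign produces a factor s. The weight
    \<open>s ^ m\<close> closes the family: the derivative of \<open>I m h\<close> is
    \<open>I (Suc m) h'\<close>.\<close>
  define I where "I m h x = integral (cbox 0 1) (\<lambda>s. s ^ m *\<^sub>R h (x * s))"
    for m :: nat and h :: "real \<Rightarrow> 'a" and x :: real
  have in_ball: "x * s \<in> ball 0 r" if "x \<in> ball 0 r" "s \<in> cbox 0 1" for x s :: real
  proof -
    have "\<bar>x\<bar> * \<bar>s\<bar> \<le> \<bar>x\<bar> * 1" using that by (intro mult_left_mono) auto
    with that show ?thesis by (auto simp: abs_mult)
  qed
  have cont: "continuous_on (ball 0 r \<times> cbox 0 1) (\<lambda>(x, s). s ^ m *\<^sub>R h (x * s))"
    if "continuous_on (ball 0 r) h" for m :: nat and h :: "real \<Rightarrow> 'a"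
    unfolding split_beta
    by (intro continuous_intros continuous_on_compose2[OF that]) (use in_ball in auto)
  have deriv: "(I m h has_vector_derivative I (Suc m) h' x) (at x)"
    if h: "\<forall>t\<in>ball 0 r. (h has_vector_derivative h' t) (at t)" and h': "continuous_on (ball 0 r) h'"
      and x: "x \<in> ball 0 r" for m x and h h' :: "real \<Rightarrow> 'a"
  proof -
    have ch: "continuous_on (ball 0 r) h"
      using h by (auto intro!: continuous_at_imp_continuous_on has_vector_derivative_continuous)
    have "((\<lambda>x. integral (cbox 0 1) (\<lambda>s. s ^ m *\<^sub>R h (x * s))) has_vector_derivative
        integral (cbox 0 1) (\<lambda>s. s ^ Suc m *\<^sub>R h' (x * s))) (at x within ball 0 r)"
    proof (rule leibniz_rule_vector_derivative)
      show "((\<lambda>x. s ^ m *\<^sub>R h (x * s)) has_vector_derivative s ^ Suc m *\<^sub>R h' (x * s)) (at x within ball 0 r)"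
        if "x \<in> ball 0 r" "s \<in> cbox 0 1" for x s
      proof -
        have "((\<lambda>x. x * s) has_vector_derivative s) (at x)"
          by (auto intro!: derivative_eq_intros)
        then have "((h \<circ> (\<lambda>x. x * s)) has_vector_derivative s *\<^sub>R h' (x * s)) (at x)"
          by (rule vector_diff_chain_at) (use h in_ball[OF that] in auto)
        from bounded_linear.has_vector_derivative[OF bounded_linear_scaleR_right this, of "s ^ m"]
        show ?thesis
          by (auto simp: o_def mult.commute intro: has_vector_derivative_at_within)
      qed
      show "(\<lambda>s. s ^ m *\<^sub>R h (x * s)) integrable_on cbox 0 1" if "x \<in> ball 0 r" for x
        by (intro integrable_continuous continuous_intros continuous_on_compose2[OF ch])
           (use in_ball that in auto)
      show "continuous_on (ball 0 r \<times> cbox 0 1) (\<lambda>(x, s). s ^ Suc m *\<^sub>R h' (x * s))"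
        using h' by (rule cont)
    qed (use x in auto)
    then show ?thesis unfolding I_def[abs_def] using x by (simp add: at_within_open[of x "ball 0 r"])
  qed
  \<comment> \<open>One order is given away, since continuity of the integral is read off from its
    differentiability. For smooth \<open>f\<close> this costs nothing.\<close>
  have Ck: "Ck_on k (ball 0 r) (I m h)" if "Ck_on (Suc k) (ball 0 r) h" for k m h
    using that
  proof (induction k arbitrary: m h)
    case 0
    then obtain h' where "\<forall>t\<in>ball 0 r. (h has_vector_derivative h' t) (at t)" "continuous_on (ball 0 r) h'"
      by auto
    from deriv[OF this] show ?case
      by (metis Ck_on.simps(1) continuous_at_imp_continuous_on has_vector_derivative_continuous)
  next
    case (Suc k)
    then obtain h' where h': "\<forall>t\<in>ball 0 r. (h has_vector_derivative h' t) (at t)" "Ck_on (Suc k) (ball 0 r) h'"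
      unfolding Ck_on.simps(2)[of "Suc k"] by blast
    have "Ck_on k (ball 0 r) (I (Suc m) h')" by (rule Suc.IH[OF h'(2)])
    with deriv[OF h'(1) Ck_on_imp_continuous_on[OF h'(2)]] show ?case
      unfolding Ck_on.simps(2) by blast
  qed
  have "Ck_on (Suc 0) (ball 0 r) f" using assms(1) smooth_on_def by blast
  then obtain f' where f': "\<forall>t\<in>ball 0 r. (f has_vector_derivative f' t) (at t)" by auto
  \<comment> \<open>Each order k comes with its own witness for the derivative; uniqueness of
    derivatives identifies all of them with \<open>f'\<close>.\<close>
  have "smooth_on (ball 0 r) f'"
    unfolding smooth_on_def
  proof
    fix k
    have "Ck_on (Suc k) (ball 0 r) f" using assms(1) smooth_on_def by blast
    then obtain g where g: "\<forall>t\<in>ball 0 r. (f has_vector_derivative g t) (at t)" "Ck_on k (ball 0 r) g" by auto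
    have "g t = f' t" if "t \<in> ball 0 r" for t
      using vector_derivative_unique_at[of f "g t" t "f' t"] g(1) f' that by simp
    then show "Ck_on k (ball 0 r) f'" by (rule Ck_on_cong[OF open_ball _ g(2)])
  qed
  then have "smooth_on (ball 0 r) (I 0 f')" unfolding smooth_on_def using Ck by blast
  moreover have "f t = t *\<^sub>R I 0 f' t" if t: "t \<in> ball 0 r" for t
  proof -
    have "((\<lambda>s. t *\<^sub>R f' (t * s)) has_integral f (t * 1) - f (t * 0)) {0..1}"
    proof (rule fundamental_theorem_of_calculus)
      fix s :: real assume s: "s \<in> {0..1}"
      have "((\<lambda>s. t * s) has_vector_derivative t) (at s within {0..1})"
        by (auto intro!: derivative_eq_intros)
      then have "((f \<circ> (\<lambda>s. t * s)) has_vector_derivative t *\<^sub>R f' (t * s)) (at s within {0..1})"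
        by (rule vector_diff_chain_within)
           (use f' in_ball[OF t] s in \<open>auto intro: has_vector_derivative_at_within\<close>)
      then show "((\<lambda>s. f (t * s)) has_vector_derivative t *\<^sub>R f' (t * s)) (at s within {0..1})"
        by (simp add: o_def)
    qed simp
    then have "f t = integral {0..1} (\<lambda>s. t *\<^sub>R f' (t * s))"
      using assms(2) by (metis diff_zero integral_unique mult.right_neutral mult_zero_right)
    then show ?thesis by (simp add: I_def)
  qed
  ultimately show thesis by (rule that)
qed

section \<open>Complex matrices\<close>

abbreviation adj :: "complex^'n^'m \<Rightarrow> complex^'m^'n" where "adj \<equiv> conjugate_transpose"

definition mat_cnj :: "complex^'n^'m \<Rightarrow> complex^'n^'m" where
  "mat_cnj A = (\<chi> i j. cnj (A $ i $ j))"

lemma adj_nth: "adj A $ i $ j = cnj (A $ j $ i)"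
  by (simp add: conjugate_transpose_def)

lemma mat_cnj_nth: "mat_cnj A $ i $ j = cnj (A $ i $ j)"
  by (simp add: mat_cnj_def)

lemma adj_adj [simp]: "adj (adj A) = A"
  by (simp add: vec_eq_iff adj_nth)

lemma adj_mult: "adj (A ** B) = adj B ** adj A"
  by (simp add: vec_eq_iff adj_nth matrix_matrix_mult_def mult.commute)

lemma adj_mat_1 [simp]: "adj (mat 1) = mat 1"
  by (auto simp: vec_eq_iff adj_nth mat_def)

lemma adj_add: "adj (A + B) = adj A + adj B"
  by (simp add: vec_eq_iff adj_nth)

lemma adj_diff: "adj (A - B) = adj A - adj B"
  by (simp add: vec_eq_iff adj_nth)

lemma adj_scaleR: "adj (c *\<^sub>R A) = c *\<^sub>R adj A"
  by (simp add: vec_eq_iff adj_nth)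

lemma mat_cnj_mult: "mat_cnj (A ** B) = mat_cnj A ** mat_cnj B"
  by (simp add: vec_eq_iff mat_cnj_nth matrix_matrix_mult_def)

lemma mat_cnj_mat_1 [simp]: "mat_cnj (mat 1) = mat 1"
  by (auto simp: vec_eq_iff mat_cnj_nth mat_def)

lemma mat_cnj_add: "mat_cnj (A + B) = mat_cnj A + mat_cnj B"
  by (simp add: vec_eq_iff mat_cnj_nth)

lemma mat_cnj_diff: "mat_cnj (A - B) = mat_cnj A - mat_cnj B"
  by (simp add: vec_eq_iff mat_cnj_nth)

lemma mat_cnj_scaleR: "mat_cnj (c *\<^sub>R A) = c *\<^sub>R mat_cnj A"
  by (simp add: vec_eq_iff mat_cnj_nth)

lemma mat_cnj_adj: "mat_cnj (adj A) = adj (mat_cnj A)"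
  by (simp add: vec_eq_iff mat_cnj_nth adj_nth)

lemma bounded_linear_adj: "bounded_linear adj"
  by (rule linear_conv_bounded_linear[THEN iffD1]) (simp add: linear_iff adj_add adj_scaleR)

lemma bounded_linear_mat_cnj: "bounded_linear mat_cnj"
  by (rule linear_conv_bounded_linear[THEN iffD1]) (simp add: linear_iff mat_cnj_add mat_cnj_scaleR)

lemma bounded_bilinear_matrix_mult:
  "bounded_bilinear ((**) :: complex^'n^'m \<Rightarrow> complex^'k^'n \<Rightarrow> complex^'k^'m)"
  by (rule bilinear_conv_bounded_bilinear[THEN iffD1])
     (simp add: bilinear_def linear_iff vec_eq_iff matrix_matrix_mult_def sum.distrib scaleR_sum_right
        algebra_simps)

interpretation matrix_mult: bounded_bilinear
  "(**) :: complex^'n^'m \<Rightarrow> complex^'k^'n \<Rightarrow> complex^'k^'m"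
  by (rule bounded_bilinear_matrix_mult)

lemmas mat_algebra_simps = matrix_mult.add_left matrix_mult.add_right matrix_mult.diff_left
  matrix_mult.diff_right matrix_mult.scaleR_left matrix_mult.scaleR_right matrix_mul_assoc

lemmas smooth_on_matrix_mult = smooth_on_bilinear[OF bounded_bilinear_matrix_mult]

lemmas smooth_on_adj = bounded_linear.smooth_on[OF bounded_linear_adj]

lemma commute_mult:
  fixes A B C :: "'a::semiring_1^'n^'n"
  assumes "A ** B = B ** A" "A ** C = C ** A"
  shows "A ** (B ** C) = B ** C ** A"
proof -
  have "A ** (B ** C) = B ** (A ** C)" by (simp add: matrix_mul_assoc assms(1))
  then show ?thesis by (simp add: assms(2) matrix_mul_assoc)
qed

lemma inner_eq_Re_sum: "inner X Y = Re (\<Sum>i\<in>UNIV. \<Sum>j\<in>UNIV. cnj (X $ i $ j) * Y $ i $ j)"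
  by (simp add: inner_vec_def inner_complex_def)

text \<open>The inherited inner product is the Frobenius one, Re tr(X* Y), so left multiplication by
  \<open>A\<close> has \<open>adj A\<close> as its adjoint.\<close>

lemma inner_matrix_mult_left:
  fixes A :: "complex^'n^'m"
  shows "inner (A ** X) Y = inner X (adj A ** Y)"
proof -
  have "(\<Sum>i\<in>UNIV. \<Sum>j\<in>UNIV. cnj ((A ** X) $ i $ j) * Y $ i $ j)
      = (\<Sum>i\<in>UNIV. \<Sum>j\<in>UNIV. \<Sum>k\<in>UNIV. cnj (X $ k $ j) * cnj (A $ i $ k) * Y $ i $ j)"
    by (simp add: matrix_matrix_mult_def sum_distrib_left sum_distrib_right mult_ac)
  also have "\<dots> = (\<Sum>j\<in>UNIV. \<Sum>i\<in>UNIV. \<Sum>k\<in>UNIV. cnj (X $ k $ j) * cnj (A $ i $ k) * Y $ i $ j)"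
    by (rule sum.swap)
  also have "\<dots> = (\<Sum>j\<in>UNIV. \<Sum>k\<in>UNIV. \<Sum>i\<in>UNIV. cnj (X $ k $ j) * cnj (A $ i $ k) * Y $ i $ j)"
    by (intro sum.cong refl sum.swap)
  also have "\<dots> = (\<Sum>k\<in>UNIV. \<Sum>j\<in>UNIV. \<Sum>i\<in>UNIV. cnj (X $ k $ j) * cnj (A $ i $ k) * Y $ i $ j)"
    by (rule sum.swap)
  also have "\<dots> = (\<Sum>k\<in>UNIV. \<Sum>j\<in>UNIV. cnj (X $ k $ j) * (adj A ** Y) $ k $ j)"
    by (simp add: matrix_matrix_mult_def sum_distrib_left adj_nth mult_ac)
  finally show ?thesis by (simp add: inner_eq_Re_sum)
qed

lemma inner_adj_adj: "inner (adj X) (adj Y) = inner X Y"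
  unfolding inner_vec_def by (subst sum.swap) (simp add: adj_nth inner_complex_def)

lemma norm_adj [simp]: "norm (adj X) = norm X"
  by (simp add: norm_eq_sqrt_inner inner_adj_adj)

lemma unitary_matrixI: "adj U ** U = mat 1 \<Longrightarrow> unitary_matrix U"
  unfolding unitary_matrix_def using matrix_left_right_inverse by blast

lemma unitary_matrixD:
  assumes "unitary_matrix U"
  shows "adj U ** U = mat 1" "U ** adj U = mat 1" "X ** adj U ** U = X" "X ** U ** adj U = X"
  using assms unfolding unitary_matrix_def by (simp_all flip: matrix_mul_assoc)

lemma unitary_matrix_mult:
  assumes "unitary_matrix U" "unitary_matrix W"
  shows "unitary_matrix (U ** W)"
  by (rule unitary_matrixI)
     (simp add: adj_mult matrix_mul_assoc unitary_matrixD[OF assms(1)] unitary_matrixD[OF assms(2)])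

lemma unitary_matrix_1: "unitary_matrix (mat 1)"
  by (simp add: unitary_matrix_def)

lemma matrix_inv_eq:
  fixes A :: "'a::field^'n^'n"
  assumes "A ** B = mat 1"
  shows "matrix_inv A = B"
proof -
  have BA: "B ** A = mat 1" using assms matrix_left_right_inverse by blast
  have "A ** matrix_inv A = mat 1 \<and> matrix_inv A ** A = mat 1"
    unfolding matrix_inv_def by (rule someI[of _ B]) (simp add: assms BA)
  then have "B ** A ** matrix_inv A = B" by (metis matrix_mul_assoc matrix_mul_rid)
  then show ?thesis by (simp add: BA)
qed

lemma hermitian_conj: "hermitian_matrix M \<Longrightarrow> hermitian_matrix (adj U ** M ** U)"
  by (simp add: hermitian_matrix_def adj_mult matrix_mul_assoc)

text \<open>The blocks are the level sets of \<open>p\<close>; they need not be contiguous and the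
  labels carry no meaning. Labels in the natural numbers allow a refinement to be encoded later as
  \<open>2 * p i\<close> plus a bit.\<close>

definition block_diagonal :: "('n \<Rightarrow> nat) \<Rightarrow> complex^'n^'n \<Rightarrow> bool" where
  "block_diagonal p M \<longleftrightarrow> (\<forall>i j. p i \<noteq> p j \<longrightarrow> M $ i $ j = 0)"

lemma diagonal_matrix_mult_nth:
  fixes d :: "'n::finite \<Rightarrow> complex"
  shows "(diagonal_matrix d ** M) $ i $ j = d i * M $ i $ j"
    and "(M ** diagonal_matrix d) $ i $ j = M $ i $ j * d j"
  by (simp_all add: diagonal_matrix_def matrix_matrix_mult_def if_distrib[where f="\<lambda>x. x * _"]
      if_distrib[where f="\<lambda>x. _ * x"] cong: if_cong)

lemma block_diagonal_commute:
  assumes "block_diagonal p M" "\<And>i j. p i = p j \<Longrightarrow> d i = d j"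
  shows "M ** diagonal_matrix d = diagonal_matrix d ** M"
  unfolding vec_eq_iff diagonal_matrix_mult_nth using assms unfolding block_diagonal_def
  by (metis mult.commute mult_zero_left)

text \<open>The (i,j) entry of the commutator is (p j - p i) times the entry of \<open>M\<close>. In
  this form the block structure is visibly closed under products and limits, and it passes to square
  roots and inverses that commute with everything the original matrix commutes with.\<close>

lemma block_diagonal_iff_commute:
  "block_diagonal p M \<longleftrightarrow>
     M ** diagonal_matrix (\<lambda>i. of_nat (p i)) = diagonal_matrix (\<lambda>i. of_nat (p i)) ** M"
proof
  assume *: "M ** diagonal_matrix (\<lambda>i. of_nat (p i)) = diagonal_matrix (\<lambda>i. of_nat (p i)) ** M"
  have "M $ i $ j * of_nat (p j) = of_nat (p i) * M $ i $ j" for i j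
    using arg_cong[OF *, of "\<lambda>X. X $ i $ j"] by (simp add: diagonal_matrix_mult_nth)
  then show "block_diagonal p M" unfolding block_diagonal_def
    by (metis mult.commute mult_cancel_left of_nat_eq_iff)
qed (rule block_diagonal_commute; simp)

lemma block_diagonal_mult:
  assumes "block_diagonal p M" "block_diagonal p N"
  shows "block_diagonal p (M ** N)"
  using assms unfolding block_diagonal_iff_commute by (metis matrix_mul_assoc)

lemma block_diagonal_adj: "block_diagonal p M \<Longrightarrow> block_diagonal p (adj M)"
  by (auto simp: block_diagonal_def adj_nth)

lemma block_diagonal_diagonal_matrix: "block_diagonal p (diagonal_matrix d)"
  by (auto simp: block_diagonal_def diagonal_matrix_def)

lemma block_diagonal_mat: "block_diagonal p (mat c)"
  by (auto simp: block_diagonal_def mat_def)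

lemma block_diagonal_add:
  "block_diagonal p M \<Longrightarrow> block_diagonal p N \<Longrightarrow> block_diagonal p (M + N)"
  by (auto simp: block_diagonal_def)

lemma block_diagonal_scaleR: "block_diagonal p M \<Longrightarrow> block_diagonal p (c *\<^sub>R M)"
  by (auto simp: block_diagonal_def)

section \<open>The spectral theorem\<close>

lemma sum_supported_on_pair:
  fixes f :: "'n::finite \<Rightarrow> 'a::comm_monoid_add"
  assumes "i \<noteq> j" "\<And>k. k \<noteq> i \<Longrightarrow> k \<noteq> j \<Longrightarrow> f k = 0"
  shows "sum f UNIV = f i + f j"
proof -
  have "sum f UNIV = sum f {i, j}"
    by (rule sum.mono_neutral_right) (use assms in auto)
  then show ?thesis using assms(1) by simp
qed

text \<open>A Givens rotation in the coordinates \<open>i\<close> and \<open>j\<close> with a phase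
  \<open>u\<close>. Choosing \<open>u\<close> as the phase of the entry to be removed reduces the
  complex case to real trigonometry; if the matrix is real, \<open>u\<close> is real.\<close>

definition plane_rotation :: "'n \<Rightarrow> 'n \<Rightarrow> real \<Rightarrow> real \<Rightarrow> complex \<Rightarrow> complex^'n^'n" where
  "plane_rotation i j c s u = (\<chi> k l.
     if l = i then (if k = i then of_real c else if k = j then of_real s * cnj u else 0)
     else if l = j then (if k = i then - of_real s * u else if k = j then of_real c else 0)
     else if k = l then 1 else 0)"

lemma
  fixes R :: "complex^'n^'n"
  assumes R: "R = plane_rotation i j c s u" and ij: "i \<noteq> j"
  shows plane_rotation_col1: "k \<noteq> i \<Longrightarrow> k \<noteq> j \<Longrightarrow> R $ k $ i = 0" "R $ i $ i = of_real c" "R $ j $ i = of_real s * cnj u"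
    and plane_rotation_col2: "k \<noteq> i \<Longrightarrow> k \<noteq> j \<Longrightarrow> R $ k $ j = 0" "R $ i $ j = - of_real s * u" "R $ j $ j = of_real c"
    and plane_rotation_col3: "l \<noteq> i \<Longrightarrow> l \<noteq> j \<Longrightarrow> R $ k $ l = (if k = l then 1 else 0)"
  using ij by (auto simp: R plane_rotation_def)

lemma adj_mult_nth: "(adj R ** R) $ k $ l = (\<Sum>m\<in>UNIV. cnj (R $ m $ k) * R $ m $ l)"
  by (simp add: matrix_matrix_mult_def adj_nth)

lemma unitary_plane_rotation:
  fixes i j :: "'n::finite"
  assumes ij: "i \<noteq> j" and cs: "c\<^sup>2 + s\<^sup>2 = 1" and u: "u * cnj u = 1"
  shows "unitary_matrix (plane_rotation i j c s u)"
proof (rule unitary_matrixI)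
  define R where "R = plane_rotation i j c s u"
  note col = plane_rotation_col1[OF R_def ij] plane_rotation_col2[OF R_def ij]
    plane_rotation_col3[OF R_def ij]
  have cs': "complex_of_real c * of_real c + of_real s * of_real s = 1"
    using arg_cong[OF cs, of complex_of_real] by (simp add: power2_eq_square)
  have col_sum: "(\<Sum>m\<in>UNIV. g m * R $ m $ l) =
      (if l = i \<or> l = j then g i * R $ i $ l + g j * R $ j $ l else g l)" for g l
  proof (cases "l = i \<or> l = j")
    case True
    then show ?thesis
      using sum_supported_on_pair[OF ij, of "\<lambda>m. g m * R $ m $ l"] col by auto
  next
    case False
    then show ?thesis by (simp add: col if_distrib[where f="\<lambda>x. _ * x"] cong: if_cong)
  qed
  have "(adj R ** R) $ k $ l = mat 1 $ k $ l" for k l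
  proof -
    have e: "u * (cnj u * x) = x" for x using u by (metis mult.assoc mult_1)
    have "of_real s * u * (of_real s * cnj u) = of_real s * complex_of_real s" by (simp add: mult_ac e)
    then show ?thesis
      unfolding adj_mult_nth col_sum using cs' ij
      by (cases "k = i"; cases "k = j"; cases "l = i"; cases "l = j")
         (simp_all add: col mat_def algebra_simps e)
  qed
  then show "adj (plane_rotation i j c s u) ** plane_rotation i j c s u = mat 1"
    by (simp add: vec_eq_iff R_def)
qed

text \<open>Only the diagonal matters for the functional that is maximised below. Because
  \<open>u\<close> is the phase of the (i,j) entry, the cross term is the real number 2csm, of first
  order in the angle, while the other changes are of second order.\<close>

lemma plane_rotation_conj_diag:
  fixes M :: "complex^'n^'n" and c s :: real
  assumes ij: "i \<noteq> j" and u: "u * cnj u = 1" and M: "hermitian_matrix M" and m: "M $ i $ j = of_real m * u"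
  defines "N \<equiv> adj (plane_rotation i j c s u) ** M ** plane_rotation i j c s u"
  shows "N $ i $ i = of_real (c\<^sup>2) * M $ i $ i + of_real (s\<^sup>2) * M $ j $ j + of_real (2 * c * s * m)"
    and "N $ j $ j = of_real (s\<^sup>2) * M $ i $ i + of_real (c\<^sup>2) * M $ j $ j - of_real (2 * c * s * m)"
    and "k \<noteq> i \<Longrightarrow> k \<noteq> j \<Longrightarrow> N $ k $ k = M $ k $ k"
proof -
  define R where "R = plane_rotation i j c s u"
  note col = plane_rotation_col1[OF R_def ij] plane_rotation_col2[OF R_def ij]
    plane_rotation_col3[OF R_def ij]
  have m': "M $ j $ i = of_real m * cnj u"
    using M m by (metis adj_nth complex_cnj_complex_of_real complex_cnj_mult hermitian_matrix_def)
  have N: "N $ k $ k = (\<Sum>y\<in>UNIV. \<Sum>x\<in>UNIV. cnj (R $ x $ k) * M $ x $ y * R $ y $ k)" for k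
    by (simp add: N_def R_def[symmetric] matrix_matrix_mult_def adj_nth sum_distrib_right)
  have pair: "N $ k $ k = (cnj (R $ i $ k) * M $ i $ i * R $ i $ k + cnj (R $ j $ k) * M $ j $ i * R $ i $ k)
      + (cnj (R $ i $ k) * M $ i $ j * R $ j $ k + cnj (R $ j $ k) * M $ j $ j * R $ j $ k)"
    if k: "\<And>l. l \<noteq> i \<Longrightarrow> l \<noteq> j \<Longrightarrow> R $ l $ k = 0" for k
    unfolding N
    by (subst sum_supported_on_pair[OF ij]; (subst sum_supported_on_pair[OF ij])?;
        (subst sum_supported_on_pair[OF ij])?; simp add: k)
  have e: "u * (cnj u * x) = x" for x using u by (metis mult.assoc mult_1)
  show "N $ i $ i = of_real (c\<^sup>2) * M $ i $ i + of_real (s\<^sup>2) * M $ j $ j + of_real (2 * c * s * m)"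
    using pair[of i] ij by (simp add: col m m' algebra_simps power2_eq_square e)
  show "N $ j $ j = of_real (s\<^sup>2) * M $ i $ i + of_real (c\<^sup>2) * M $ j $ j - of_real (2 * c * s * m)"
    using pair[of j] ij by (simp add: col m m' algebra_simps power2_eq_square e)
  show "N $ k $ k = M $ k $ k" if "k \<noteq> i" "k \<noteq> j"
    using that
    by (simp add: N_def R_def[symmetric] matrix_matrix_mult_def adj_nth col if_distrib[where f="\<lambda>x. _ * x"] if_distrib[where f="\<lambda>x. x * _"]
        if_distrib[where f=cnj] cong: if_cong)
qed

lemma norm_unitary_matrix:
  fixes U :: "complex^'n^'n"
  assumes "unitary_matrix U"
  shows "norm U = norm (mat 1 :: complex^'n^'n)"
proof -
  have "inner U U = inner (U ** mat 1) U" by simp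
  also have "\<dots> = inner (mat 1) (adj U ** U)" by (rule inner_matrix_mult_left)
  finally show ?thesis using assms by (simp add: norm_eq_sqrt_inner unitary_matrixD)
qed

lemma compact_unitary_block:
  "compact {U :: complex^'n^'n. unitary_matrix U \<and> block_diagonal p U \<and> (b \<longrightarrow> mat_cnj U = U)}"
proof -
  have adj: "continuous_on UNIV (\<lambda>U :: complex^'n^'n. adj U)"
    using linear_continuous_on[OF bounded_linear_adj] by simp
  have mc: "continuous_on UNIV (\<lambda>U :: complex^'n^'n. mat_cnj U)"
    using linear_continuous_on[OF bounded_linear_mat_cnj] by simp
  have "closed {U :: complex^'n^'n. adj U ** U = mat 1 \<and> U ** adj U = mat 1}"
    by (intro closed_Collect_conj closed_Collect_eq matrix_mult.continuous_on continuous_intros adj)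
  moreover have "closed {U :: complex^'n^'n. b \<longrightarrow> mat_cnj U = U}"
    by (cases b) (auto intro!: closed_Collect_eq mc)
  moreover have "closed {U. block_diagonal p U}"
    unfolding block_diagonal_iff_commute
    by (intro closed_Collect_eq matrix_mult.continuous_on continuous_intros)
  ultimately have "closed {U :: complex^'n^'n. unitary_matrix U \<and> block_diagonal p U \<and> (b \<longrightarrow> mat_cnj U = U)}"
    unfolding unitary_matrix_def[symmetric] Collect_conj_eq by (intro closed_Int)
  moreover have "bounded {U :: complex^'n^'n. unitary_matrix U \<and> block_diagonal p U \<and> (b \<longrightarrow> mat_cnj U = U)}"
    by (rule boundedI[of _ "norm (mat 1 :: complex^'n^'n)"]) (auto simp: norm_unitary_matrix)
  ultimately show ?thesis using compact_eq_bounded_closed by blast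
qed

text \<open>A maximiser of \<open>\<Sum>\<^sub>k w\<^sub>k (U\<^sup>* A U)\<^sub>k\<^sub>k\<close> with pairwise distinct weights \<open>w\<^sub>k\<close> diagonalises \<open>A\<close>,
  because a plane rotation changes the functional to first order by the off-diagonal entry.\<close>

lemma spectral_theorem_block:
  fixes A :: "complex^'n^'n"
  assumes A: "hermitian_matrix A" "block_diagonal p A" "b \<longrightarrow> mat_cnj A = A"
  obtains U d where "unitary_matrix U" "block_diagonal p U" "b \<longrightarrow> mat_cnj U = U"
    "adj U ** A ** U = diagonal_matrix (\<lambda>i. complex_of_real (d i))"
proof -
  obtain w :: "'n \<Rightarrow> nat" where w: "inj w"
    using finite_imp_inj_to_nat_seg[of "UNIV :: 'n set"] by auto
  define K where "K = {U :: complex^'n^'n. unitary_matrix U \<and> block_diagonal p U \<and> (b \<longrightarrow> mat_cnj U = U)}"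
  define f where "f M = (\<Sum>k\<in>UNIV. real (w k) * Re (M $ k $ k))" for M :: "complex^'n^'n"
  have "continuous_on K (\<lambda>U. f (adj U ** A ** U))"
    unfolding f_def
    by (intro continuous_intros matrix_mult.continuous_on linear_continuous_on bounded_linear_adj)
  moreover have "mat 1 \<in> K" by (auto simp: K_def unitary_matrix_1 block_diagonal_mat)
  moreover have "compact K" unfolding K_def by (rule compact_unitary_block)
  ultimately obtain U where U: "U \<in> K" and max: "\<And>X. X \<in> K \<Longrightarrow> f (adj X ** A ** X) \<le> f (adj U ** A ** U)"
    using continuous_attains_sup[of K "\<lambda>U. f (adj U ** A ** U)"] by auto
  have U': "unitary_matrix U" "block_diagonal p U" "b \<longrightarrow> mat_cnj U = U" using U by (auto simp: K_def)
  define M where "M = adj U ** A ** U"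
  have M: "hermitian_matrix M" unfolding M_def using A(1) by (rule hermitian_conj)
  have pM: "block_diagonal p M"
    unfolding M_def using A U' by (intro block_diagonal_mult block_diagonal_adj)
  have bM: "b \<longrightarrow> mat_cnj M = M"
    unfolding M_def using A U' by (simp add: mat_cnj_mult mat_cnj_adj)
  have off: "M $ i $ j = 0" if ij: "i \<noteq> j" for i j
  proof (rule ccontr)
    assume nz: "M $ i $ j \<noteq> 0"
    \<comment> \<open>A nonzero entry lies inside a block, so rotating in the plane of
      \<open>i\<close> and \<open>j\<close> respects the blocks and stays among the admissible
      competitors.\<close>
    then have pij: "p i = p j" using pM by (auto simp: block_diagonal_def)
    define m where "m = cmod (M $ i $ j)"
    define u where "u = M $ i $ j / of_real m"
    have m0: "m > 0" using nz by (simp add: m_def)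
    have um: "M $ i $ j = of_real m * u" using m0 by (simp add: u_def)
    have u1: "u * cnj u = 1"
      using m0 by (simp add: u_def complex_norm_square[symmetric] m_def power2_eq_square flip: of_real_mult)
    have bu: "b \<longrightarrow> cnj u = u"
      using bM by (metis complex_cnj_complex_of_real complex_cnj_divide mat_cnj_nth u_def)
    define D where "D = real (w i) - real (w j)"
    define a where "a = Re (M $ i $ i)"
    define d where "d = Re (M $ j $ j)"
    have D0: "D \<noteq> 0" using w ij by (auto simp: D_def inj_def)
    have ineq: "D * (t\<^sup>2 * (d - a) + 2 * t * m) \<le> 0" for t :: real
    proof -
      \<comment> \<open>The parametrisation of the circle by the tangent \<open>t\<close> of the
        angle: after multiplication by \<open>r\<close> squared, maximality becomes a quadratic
        inequality in \<open>t\<close>.\<close>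
      define r where "r = sqrt (1 + t\<^sup>2)"
      have r: "r > 0" "r\<^sup>2 = 1 + t\<^sup>2" by (auto simp: r_def add_pos_nonneg)
      define c where "c = 1 / r"
      define s where "s = t / r"
      have c2: "c\<^sup>2 = 1 / r\<^sup>2" and s2: "s\<^sup>2 = t\<^sup>2 / r\<^sup>2" and cs: "c * s = t / r\<^sup>2"
        by (auto simp: c_def s_def power_divide power2_eq_square)
      have c1: "c\<^sup>2 + s\<^sup>2 = 1"
        using r by (metis add_divide_distrib c2 s2 divide_self less_irrefl power_not_zero)
      let ?R = "plane_rotation i j c s u"
      have "block_diagonal p ?R"
        unfolding block_diagonal_def
      proof (intro allI impI)
        fix k l assume "p k \<noteq> p l"
        then have "k \<noteq> l" "\<not> (k = i \<and> l = j)" "\<not> (k = j \<and> l = i)" using pij by auto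
        then show "?R $ k $ l = 0" unfolding plane_rotation_def by auto
      qed
      moreover have "b \<longrightarrow> mat_cnj ?R = ?R"
        using bu by (simp add: vec_eq_iff mat_cnj_nth plane_rotation_def)
      moreover have "unitary_matrix ?R" by (rule unitary_plane_rotation[OF ij c1 u1])
      ultimately have "U ** ?R \<in> K"
        using U' unfolding K_def by (auto simp: unitary_matrix_mult block_diagonal_mult mat_cnj_mult)
      from max[OF this] have "f (adj ?R ** M ** ?R) \<le> f M"
        by (simp add: M_def adj_mult matrix_mul_assoc)
      then have "(\<Sum>k\<in>UNIV. real (w k) * (Re ((adj ?R ** M ** ?R) $ k $ k) - Re (M $ k $ k))) \<le> 0"
        by (simp add: f_def right_diff_distrib sum_subtractf)
      also have "(\<Sum>k\<in>UNIV. real (w k) * (Re ((adj ?R ** M ** ?R) $ k $ k) - Re (M $ k $ k)))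
          = real (w i) * (Re ((adj ?R ** M ** ?R) $ i $ i) - Re (M $ i $ i))
          + real (w j) * (Re ((adj ?R ** M ** ?R) $ j $ j) - Re (M $ j $ j))"
        by (rule sum_supported_on_pair[OF ij]) (simp add: plane_rotation_conj_diag[OF ij u1 M um])
      also have "\<dots> = real (w i) * (c\<^sup>2 * a + s\<^sup>2 * d + 2 * c * s * m - a)
          + real (w j) * (s\<^sup>2 * a + c\<^sup>2 * d - 2 * c * s * m - d)"
        unfolding plane_rotation_conj_diag[OF ij u1 M um] a_def d_def
        by (simp flip: of_real_mult of_real_power)
      also have "c\<^sup>2 = 1 - s\<^sup>2" using c1 by simp
      also have "real (w i) * ((1 - s\<^sup>2) * a + s\<^sup>2 * d + 2 * c * s * m - a)
          + real (w j) * (s\<^sup>2 * a + (1 - s\<^sup>2) * d - 2 * c * s * m - d) = D * (s\<^sup>2 * (d - a) + 2 * (c * s) * m)"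
        by (simp add: D_def algebra_simps)
      also have "\<dots> = D * (t\<^sup>2 * (d - a) + 2 * t * m) / r\<^sup>2"
        unfolding s2 cs by (simp add: add_divide_distrib diff_divide_distrib algebra_simps)
      finally show ?thesis using r(1) by (simp add: divide_le_0_iff)
    qed
    \<comment> \<open>\<open>t\<close> is small with the sign of \<open>D\<close>, so that the linear term dominates.\<close>
    define t where "t = sgn D * m / (\<bar>d - a\<bar> + 1)"
    have t: "\<bar>t\<bar> * (\<bar>d - a\<bar> + 1) = m" "D * t = \<bar>D\<bar> * \<bar>t\<bar>" "t \<noteq> 0"
      using m0 D0 by (auto simp: t_def abs_mult sgn_if)
    have "\<bar>D * t\<^sup>2 * (d - a)\<bar> = \<bar>D\<bar> * \<bar>t\<bar> * (\<bar>t\<bar> * \<bar>d - a\<bar>)"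
      by (simp add: abs_mult power2_eq_square)
    also have "\<bar>t\<bar> * \<bar>d - a\<bar> = m - \<bar>t\<bar>" using t(1) by (simp add: algebra_simps)
    finally have "- (\<bar>D\<bar> * \<bar>t\<bar> * (m - \<bar>t\<bar>)) \<le> D * t\<^sup>2 * (d - a)"
      by linarith
    moreover have "D * t\<^sup>2 * (d - a) + 2 * (D * t) * m \<le> 0"
      using ineq[of t] by (simp add: algebra_simps)
    ultimately have "- (\<bar>D\<bar> * \<bar>t\<bar> * (m - \<bar>t\<bar>)) + 2 * (\<bar>D\<bar> * \<bar>t\<bar>) * m \<le> 0"
      unfolding t(2) by linarith
    then have "\<bar>D\<bar> * \<bar>t\<bar> * (m + \<bar>t\<bar>) \<le> 0" by (simp add: algebra_simps)
    moreover have "\<bar>D\<bar> * \<bar>t\<bar> * (m + \<bar>t\<bar>) > 0" using D0 t(3) m0 by simp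
    ultimately show False by simp
  qed
  have "M $ i $ i = of_real (Re (M $ i $ i))" for i
    using M by (metis Reals_cnj_iff adj_nth hermitian_matrix_def of_real_Re)
  then have "M = diagonal_matrix (\<lambda>i. complex_of_real (Re (M $ i $ i)))"
    using off by (auto simp: vec_eq_iff diagonal_matrix_def)
  from that[OF U' this[unfolded M_def]] show thesis .
qed

section \<open>Sylvester equations and smooth square roots\<close>

text \<open>Positivity is tested on matrices \<open>Y\<close>, column by column the usual condition
  on vectors, because the Sylvester operator acts on matrices.\<close>

definition pos_def_ge :: "real \<Rightarrow> complex^'n^'n \<Rightarrow> bool" where
  "pos_def_ge c T \<longleftrightarrow> hermitian_matrix T \<and> (\<forall>Y :: complex^'n^'n. c * (norm Y)\<^sup>2 \<le> inner Y (T ** Y))"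

lemma pos_def_ge_right:
  fixes T Y :: "complex^'n^'n"
  assumes "pos_def_ge c T"
  shows "c * (norm Y)\<^sup>2 \<le> inner Y (Y ** T)"
proof -
  have "inner Y (Y ** T) = inner (adj Y) (T ** adj Y)"
    using assms by (metis adj_mult hermitian_matrix_def inner_adj_adj pos_def_ge_def)
  moreover have "c * (norm (adj Y))\<^sup>2 \<le> inner (adj Y) (T ** adj Y)"
    using assms unfolding pos_def_ge_def by blast
  ultimately show ?thesis by simp
qed

text \<open>Pairing with \<open>Y\<close> gives at least 2c |Y|^2, and Cauchy-Schwarz finishes. The
  constant depends only on \<open>c\<close>, so the estimate is uniform along a family; two
  different coefficients are allowed because differences of square roots lead to such
  equations.\<close>

lemma Sylvester_bound:
  fixes S T Y :: "complex^'n^'n"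
  assumes "c > 0" "pos_def_ge c S" "pos_def_ge c T"
  shows "norm Y \<le> norm (S ** Y + Y ** T) / (2 * c)"
proof (cases "Y = 0")
  case False
  have "c * (norm Y)\<^sup>2 \<le> inner Y (S ** Y)" using assms(2) unfolding pos_def_ge_def by blast
  then have "2 * c * (norm Y)\<^sup>2 \<le> inner Y (S ** Y) + inner Y (Y ** T)"
    using pos_def_ge_right[OF assms(3), of Y] by linarith
  also have "\<dots> = inner Y (S ** Y + Y ** T)" by (simp add: inner_add_right)
  also have "\<dots> \<le> norm Y * norm (S ** Y + Y ** T)" by (rule norm_cauchy_schwarz)
  finally have "norm Y * (norm Y * (2 * c)) \<le> norm Y * norm (S ** Y + Y ** T)"
    by (simp add: power2_eq_square algebra_simps)
  then have "norm Y * (2 * c) \<le> norm (S ** Y + Y ** T)" using False by simp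
  then show ?thesis using assms(1) by (simp add: field_simps)
qed (use assms in simp)

lemma Sylvester_eq_0:
  fixes S T Y :: "complex^'n^'n"
  assumes "c > 0" "pos_def_ge c S" "pos_def_ge c T" "S ** Y + Y ** T = 0"
  shows "Y = 0"
  using Sylvester_bound[OF assms(1-3), of Y] assms(4) by simp

text \<open>The a priori bound makes the operator injective, hence surjective in finite
  dimension.\<close>

lemma Sylvester_solvable:
  fixes S T K :: "complex^'n^'n"
  assumes "c > 0" "pos_def_ge c S" "pos_def_ge c T"
  obtains Y where "S ** Y + Y ** T = K"
proof -
  have lin: "linear (\<lambda>Y. S ** Y + Y ** T)"
    by (simp add: linear_iff mat_algebra_simps scaleR_add_right)
  have "inj (\<lambda>Y. S ** Y + Y ** T)"
    unfolding linear_injective_0[OF lin] using Sylvester_eq_0[OF assms] by blast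
  with lin have "surj (\<lambda>Y. S ** Y + Y ** T)" by (rule linear_injective_imp_surjective) (rule refl)
  then obtain Y where "K = S ** Y + Y ** T" by (rule surjE)
  from that[OF this[symmetric]] show thesis .
qed

text \<open>The difference \<open>Y s - Z\<close> solves a Sylvester equation whose right-hand side
  tends to 0, and the bound is uniform. Nothing is assumed about convergence of \<open>Y\<close>;
  applied to difference quotients, this proves differentiability.\<close>

lemma tendsto_Sylvester:
  fixes X X' Y R :: "'a \<Rightarrow> complex^'n^'n"
  assumes c: "c > 0" and pos: "\<forall>\<^sub>F s in F. pos_def_ge c (X s)" "\<forall>\<^sub>F s in F. pos_def_ge c (X' s)"
    and lim: "(X \<longlongrightarrow> X0) F" "(X' \<longlongrightarrow> X0') F" "(R \<longlongrightarrow> X0 ** Z + Z ** X0') F"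
    and eq: "\<forall>\<^sub>F s in F. X s ** Y s + Y s ** X' s = R s"
  shows "(Y \<longlongrightarrow> Z) F"
proof -
  have "((\<lambda>s. norm (R s - (X s ** Z + Z ** X' s)) / (2 * c)) \<longlongrightarrow>
      norm (X0 ** Z + Z ** X0' - (X0 ** Z + Z ** X0')) / (2 * c)) F"
    using c by (intro tendsto_intros lim matrix_mult.tendsto) auto
  then have lim0: "((\<lambda>s. norm (R s - (X s ** Z + Z ** X' s)) / (2 * c)) \<longlongrightarrow> 0) F" by simp
  have "\<forall>\<^sub>F s in F. norm (Y s - Z) \<le> norm (R s - (X s ** Z + Z ** X' s)) / (2 * c)"
    using pos eq
  proof eventually_elim
    case (elim s)
    have "X s ** (Y s - Z) + (Y s - Z) ** X' s = R s - (X s ** Z + Z ** X' s)"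
      using elim(3) by (simp add: mat_algebra_simps algebra_simps)
    then show ?case using Sylvester_bound[OF c elim(1,2), of "Y s - Z"] by simp
  qed
  then have "((\<lambda>s. Y s - Z) \<longlongrightarrow> 0) F" by (rule Lim_null_comparison[OF _ lim0])
  then show ?thesis by (simp add: LIM_zero_iff)
qed

lemma has_vector_derivative_iff_tendsto:
  "(f has_vector_derivative D) (at t) \<longleftrightarrow> ((\<lambda>s. (f s - f t) /\<^sub>R (s - t)) \<longlongrightarrow> D) (at t)"
proof -
  have eq: "norm (f s - f t - (s - t) *\<^sub>R D) / norm (s - t) = norm ((f s - f t) /\<^sub>R (s - t) - D)"
    if "s \<noteq> t" for s
  proof -
    have "f s - f t - (s - t) *\<^sub>R D = (s - t) *\<^sub>R ((f s - f t) /\<^sub>R (s - t) - D)"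
      using that by (simp add: scaleR_diff_right)
    then show ?thesis using that by simp
  qed
  have "(f has_vector_derivative D) (at t) \<longleftrightarrow>
      ((\<lambda>s. norm (f s - f t - (s - t) *\<^sub>R D) / norm (s - t)) \<longlongrightarrow> 0) (at t)"
    by (simp add: has_vector_derivative_def has_derivative_iff_norm bounded_linear_scaleR_left)
  also have "\<dots> \<longleftrightarrow> ((\<lambda>s. norm ((f s - f t) /\<^sub>R (s - t) - D)) \<longlongrightarrow> 0) (at t)"
    by (rule tendsto_cong) (use eq in \<open>auto simp: eventually_at_filter\<close>)
  also have "\<dots> \<longleftrightarrow> ((\<lambda>s. (f s - f t) /\<^sub>R (s - t)) \<longlongrightarrow> D) (at t)"
    by (simp add: tendsto_norm_zero_iff LIM_zero_iff)
  finally show ?thesis .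
qed

text \<open>Formal differentiation gives a Sylvester equation with the same coefficient
  \<open>T\<close> for the candidate derivative, so the induction can be applied to that
  derivative.\<close>

lemma Sylvester_Ck_on:
  fixes T Y K :: "real \<Rightarrow> complex^'n^'n"
  assumes V: "open V" and c: "c > 0" and pos: "\<And>t. t \<in> V \<Longrightarrow> pos_def_ge c (T t)"
    and "\<And>t. t \<in> V \<Longrightarrow> T t ** Y t + Y t ** T t = K t" "Ck_on k V T" "Ck_on k V K"
  shows "Ck_on k V Y"
  using assms(4-)
proof (induction k arbitrary: Y K)
  case 0
  have "(Y \<longlongrightarrow> Y t) (at t)" if t: "t \<in> V" for t
  proof (rule tendsto_Sylvester[OF c])
    have ev: "\<forall>\<^sub>F s in at t. s \<in> V" using V t by (rule eventually_at_in_open')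
    show "\<forall>\<^sub>F s in at t. pos_def_ge c (T s)" "\<forall>\<^sub>F s in at t. pos_def_ge c (T s)"
      using ev pos by (auto elim: eventually_mono)
    show "\<forall>\<^sub>F s in at t. T s ** Y s + Y s ** T s = K s"
      using ev 0(1) by (auto elim: eventually_mono)
    show "(T \<longlongrightarrow> T t) (at t)" "(T \<longlongrightarrow> T t) (at t)" "(K \<longlongrightarrow> T t ** Y t + Y t ** T t) (at t)"
      using 0 t V by (auto simp: continuous_on_eq_continuous_at isCont_def)
  qed
  then show ?case using V by (simp add: continuous_on_eq_continuous_at isCont_def)
next
  case (Suc k)
  obtain T' where T': "\<forall>t\<in>V. (T has_vector_derivative T' t) (at t)" "Ck_on k V T'" using Suc.prems by auto
  obtain K' where K': "\<forall>t\<in>V. (K has_vector_derivative K' t) (at t)" "Ck_on k V K'" using Suc.prems by auto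
  have Tk: "Ck_on k V T" "Ck_on k V K" using Suc.prems Ck_on_Suc_imp by blast+
  define L where "L t = K' t - (T' t ** Y t + Y t ** T' t)" for t
  have "\<exists>Z. T t ** Z + Z ** T t = L t" if "t \<in> V" for t
    using Sylvester_solvable[OF c pos[OF that] pos[OF that]] by metis
  then obtain Z where Z: "\<And>t. t \<in> V \<Longrightarrow> T t ** Z t + Z t ** T t = L t" by metis
  have "(Y has_vector_derivative Z t) (at t)" if t: "t \<in> V" for t
    unfolding has_vector_derivative_iff_tendsto
  proof (rule tendsto_Sylvester[OF c])
    \<comment> \<open>The exact right-hand side of the equation for the difference quotient,
      obtained by subtracting the equations at \<open>s\<close> and \<open>t\<close> while keeping
      the coefficient \<open>T s\<close>.\<close>
    let ?R = "\<lambda>s. (K s - K t) /\<^sub>R (s - t)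
      - ((T s - T t) /\<^sub>R (s - t) ** Y t + Y t ** ((T s - T t) /\<^sub>R (s - t)))"
    have ev: "\<forall>\<^sub>F s in at t. s \<in> V" using V t by (rule eventually_at_in_open')
    show "\<forall>\<^sub>F s in at t. pos_def_ge c (T s)" "\<forall>\<^sub>F s in at t. pos_def_ge c (T s)"
      using ev pos by (auto elim: eventually_mono)
    show "(T \<longlongrightarrow> T t) (at t)" "(T \<longlongrightarrow> T t) (at t)"
      using Ck_on_imp_continuous_on[OF Tk(1)] t V by (auto simp: continuous_on_eq_continuous_at isCont_def)
    show "(?R \<longlongrightarrow> T t ** Z t + Z t ** T t) (at t)"
      unfolding Z[OF t] L_def
      using T'(1) K'(1) t unfolding has_vector_derivative_iff_tendsto
      by (intro tendsto_intros matrix_mult.tendsto) auto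
    show "\<forall>\<^sub>F s in at t. T s ** ((Y s - Y t) /\<^sub>R (s - t)) + ((Y s - Y t) /\<^sub>R (s - t)) ** T s = ?R s"
      using ev
    proof eventually_elim
      case (elim s)
      have "T s ** (Y s - Y t) + (Y s - Y t) ** T s = K s - K t - ((T s - T t) ** Y t + Y t ** (T s - T t))"
        using Suc.prems(1)[OF elim, symmetric] Suc.prems(1)[OF t, symmetric]
        by (simp add: mat_algebra_simps algebra_simps)
      then show ?case
        by (simp add: matrix_mult.scaleR_left matrix_mult.scaleR_right flip: scaleR_add_right scaleR_diff_right)
    qed
  qed
  \<comment> \<open>The induction hypothesis is used twice: for \<open>Y\<close> itself, which makes
    \<open>L\<close> of class k, and then for \<open>Z\<close> with right-hand side
    \<open>L\<close>.\<close>
  moreover have "Ck_on k V Y" using Suc.IH[OF Suc.prems(1)] Tk by blast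
  then have "Ck_on k V (\<lambda>t. T' t ** Y t + Y t ** T' t)"
    using T'(2) by (intro Ck_on_add Ck_on_bilinear[OF bounded_bilinear_matrix_mult])
  from bounded_linear.Ck_on[OF bounded_linear_minus[OF bounded_linear_ident] this] K'(2)
  have "Ck_on k V L" unfolding L_def[abs_def] diff_conv_add_uminus by (intro Ck_on_add)
  then have "Ck_on k V Z" using Suc.IH[OF Z] Tk by blast
  ultimately show ?case by auto
qed

text \<open>Everything rests on T(s)^2 - T(t)^2 = T(s) (T(s) - T(t)) + (T(s) - T(t)) T(t), a
  Sylvester equation for the increment. It yields continuity first, then the derivative; the
  derivative is as regular as \<open>T\<close> is already known to be, and this bootstraps.\<close>

lemma matrix_sqrt_smooth_on:
  fixes T H :: "real \<Rightarrow> complex^'n^'n"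
  assumes V: "open V" and c: "c > 0" and pos: "\<And>t. t \<in> V \<Longrightarrow> pos_def_ge c (T t)"
    and sq: "\<And>t. t \<in> V \<Longrightarrow> T t ** T t = H t" and H: "smooth_on V H"
  shows "smooth_on V T"
proof -
  have cont: "(T \<longlongrightarrow> T t) (at t)" if t: "t \<in> V" for t
  proof -
    have ev: "\<forall>\<^sub>F s in at t. s \<in> V" using V t by (rule eventually_at_in_open')
    have "((\<lambda>s. norm (H s - H t) / (2 * c)) \<longlongrightarrow> norm (H t - H t) / (2 * c)) (at t)"
      using smooth_on_imp_continuous_on[OF H] V t c
      by (intro tendsto_intros) (auto simp: continuous_on_eq_continuous_at isCont_def)
    then have "((\<lambda>s. norm (H s - H t) / (2 * c)) \<longlongrightarrow> 0) (at t)" by simp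
    moreover have "\<forall>\<^sub>F s in at t. norm (T s - T t) \<le> norm (H s - H t) / (2 * c)"
      using ev
    proof eventually_elim
      case (elim s)
      have "T s ** (T s - T t) + (T s - T t) ** T t = H s - H t"
        using sq[OF elim] sq[OF t] by (simp add: mat_algebra_simps)
      then show ?case using Sylvester_bound[OF c pos[OF elim] pos[OF t], of "T s - T t"] by simp
    qed
    ultimately have "((\<lambda>s. T s - T t) \<longlongrightarrow> 0) (at t)" by (rule Lim_null_comparison[rotated])
    then show ?thesis by (simp add: LIM_zero_iff)
  qed
  have "Ck_on k V T" for k
  proof (induction k)
    case 0
    show ?case using V cont by (simp add: continuous_on_eq_continuous_at isCont_def)
  next
    case (Suc k)
    have "Ck_on (Suc k) V H" using H smooth_on_def by blast
    then obtain H' where H': "\<forall>t\<in>V. (H has_vector_derivative H' t) (at t)" "Ck_on k V H'" by auto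
    have "\<exists>Z. T t ** Z + Z ** T t = H' t" if "t \<in> V" for t
      using Sylvester_solvable[OF c pos[OF that] pos[OF that]] by metis
    then obtain Z where Z: "\<And>t. t \<in> V \<Longrightarrow> T t ** Z t + Z t ** T t = H' t" by metis
    have "(T has_vector_derivative Z t) (at t)" if t: "t \<in> V" for t
      unfolding has_vector_derivative_iff_tendsto
    proof (rule tendsto_Sylvester[OF c])
      have ev: "\<forall>\<^sub>F s in at t. s \<in> V" using V t by (rule eventually_at_in_open')
      show "\<forall>\<^sub>F s in at t. pos_def_ge c (T s)" "\<forall>\<^sub>F s in at t. pos_def_ge c (T t)"
        using ev pos t by (auto elim: eventually_mono)
      show "(T \<longlongrightarrow> T t) (at t)" "((\<lambda>s. T t) \<longlongrightarrow> T t) (at t)"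
        using cont t by auto
      show "((\<lambda>s. (H s - H t) /\<^sub>R (s - t)) \<longlongrightarrow> T t ** Z t + Z t ** T t) (at t)"
        unfolding Z[OF t] using H'(1) t by (simp add: has_vector_derivative_iff_tendsto)
      show "\<forall>\<^sub>F s in at t. T s ** ((T s - T t) /\<^sub>R (s - t)) + ((T s - T t) /\<^sub>R (s - t)) ** T t
          = (H s - H t) /\<^sub>R (s - t)"
        using ev
      proof eventually_elim
        case (elim s)
        have "T s ** (T s - T t) + (T s - T t) ** T t = H s - H t"
          using sq[OF elim] sq[OF t] by (simp add: mat_algebra_simps)
        then show ?case
          by (simp add: matrix_mult.scaleR_left matrix_mult.scaleR_right flip: scaleR_add_right)
      qed
    qed
    moreover have "Ck_on k V Z"
      using Sylvester_Ck_on[OF V c pos Z Suc H'(2)] by blast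
    ultimately show ?case by auto
  qed
  then show ?thesis by (simp add: smooth_on_def)
qed

section \<open>Positive square roots of single matrices and of smooth families\<close>

lemma pos_def_ge_mono: "pos_def_ge c T \<Longrightarrow> a \<le> c \<Longrightarrow> pos_def_ge a T"
  unfolding pos_def_ge_def by (meson mult_right_mono order_trans zero_le_power2)

lemma pos_def_ge_unitary_conj:
  fixes M U :: "complex^'n^'n"
  assumes "pos_def_ge c M" "unitary_matrix U"
  shows "pos_def_ge c (adj U ** M ** U)"
  unfolding pos_def_ge_def
proof (intro conjI allI)
  show "hermitian_matrix (adj U ** M ** U)"
    using assms(1) by (simp add: pos_def_ge_def hermitian_conj)
  fix Y :: "complex^'n^'n"
  have "inner (U ** Y) (U ** Y) = inner Y Y"
    by (simp add: inner_matrix_mult_left matrix_mul_assoc unitary_matrixD[OF assms(2)])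
  then have n: "norm (U ** Y) = norm Y" by (simp add: norm_eq_sqrt_inner)
  have "c * (norm (U ** Y))\<^sup>2 \<le> inner (U ** Y) (M ** (U ** Y))"
    using assms(1) unfolding pos_def_ge_def by blast
  also have "\<dots> = inner Y (adj U ** M ** U ** Y)"
    by (simp add: inner_matrix_mult_left matrix_mul_assoc)
  finally show "c * (norm Y)\<^sup>2 \<le> inner Y (adj U ** M ** U ** Y)" by (simp add: n)
qed

lemma hermitian_diagonal_matrix: "hermitian_matrix (diagonal_matrix (\<lambda>i. complex_of_real (d i)))"
  by (auto simp: hermitian_matrix_def vec_eq_iff adj_nth diagonal_matrix_def)

lemma mat_cnj_diagonal_matrix:
  "mat_cnj (diagonal_matrix (\<lambda>i. complex_of_real (d i))) = diagonal_matrix (\<lambda>i. complex_of_real (d i))"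
  by (auto simp: vec_eq_iff mat_cnj_nth diagonal_matrix_def)

lemma diagonal_matrix_mult_diagonal_matrix:
  "diagonal_matrix (\<lambda>i. complex_of_real (d i)) ** diagonal_matrix (\<lambda>i. complex_of_real (e i))
   = diagonal_matrix (\<lambda>i. complex_of_real (d i * e i))"
  unfolding vec_eq_iff diagonal_matrix_mult_nth by (simp add: diagonal_matrix_def)

lemma diagonal_matrix_1: "diagonal_matrix (\<lambda>i. 1) = mat 1"
  by (simp add: diagonal_matrix_def mat_def)

lemma norm_matrix_sum: "(norm (Y :: complex^'n^'m))\<^sup>2 = (\<Sum>i\<in>UNIV. \<Sum>j\<in>UNIV. (cmod (Y $ i $ j))\<^sup>2)"
  by (simp add: power2_norm_eq_inner inner_vec_def)

lemma inner_diagonal_matrix_mult: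
  fixes Y :: "complex^'n^'n"
  shows "inner Y (diagonal_matrix (\<lambda>i. complex_of_real (d i)) ** Y) = (\<Sum>i\<in>UNIV. d i * (\<Sum>j\<in>UNIV. (cmod (Y $ i $ j))\<^sup>2))"
proof -
  have "inner (z :: complex) (of_real a * z) = a * (cmod z)\<^sup>2" for a z
    by (metis inner_scaleR_right power2_norm_eq_inner scaleR_conv_of_real)
  then show ?thesis
    by (simp add: inner_vec_def diagonal_matrix_mult_nth sum_distrib_left)
qed

lemma pos_def_ge_diagonal_matrix_iff:
  fixes d :: "'n::finite \<Rightarrow> real"
  shows "pos_def_ge c (diagonal_matrix (\<lambda>i. complex_of_real (d i))) \<longleftrightarrow> (\<forall>i. c \<le> d i)"
proof
  assume *: "pos_def_ge c (diagonal_matrix (\<lambda>i. complex_of_real (d i)))"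
  show "\<forall>i. c \<le> d i"
  proof
    fix i
    define E :: "complex^'n^'n" where "E = (\<chi> k l. if k = i \<and> l = i then 1 else 0)"
    have row: "(\<Sum>l\<in>UNIV. (cmod (E $ k $ l))\<^sup>2) = (if k = i then 1 else 0)" for k
      by (auto simp: E_def if_distrib[where f="\<lambda>x. (cmod x)\<^sup>2"] cong: if_cong)
    have "c * (norm E)\<^sup>2 \<le> inner E (diagonal_matrix (\<lambda>i. complex_of_real (d i)) ** E)"
      using * unfolding pos_def_ge_def by blast
    then show "c \<le> d i"
      unfolding norm_matrix_sum inner_diagonal_matrix_mult row
      by (simp add: if_distrib[where f="\<lambda>x. _ * x"] cong: if_cong)
  qed
next
  assume *: "\<forall>i. c \<le> d i"
  show "pos_def_ge c (diagonal_matrix (\<lambda>i. complex_of_real (d i)))"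
    unfolding pos_def_ge_def norm_matrix_sum inner_diagonal_matrix_mult
    using * by (auto simp: hermitian_diagonal_matrix sum_distrib_left intro!: sum_mono mult_right_mono)
qed

lemma pos_def_ge_perturb:
  fixes T :: "complex^'n^'n"
  assumes T: "pos_def_ge c T" and c: "c > 0"
  obtains \<delta> where "\<delta> > 0" "\<And>T'. hermitian_matrix T' \<Longrightarrow> norm (T' - T) < \<delta> \<Longrightarrow> pos_def_ge (c / 2) T'"
proof -
  obtain K where K: "K > 0" "\<And>(A :: complex^'n^'n) (B :: complex^'n^'n). norm (A ** B) \<le> norm A * norm B * K"
    using matrix_mult.pos_bounded by metis
  \<comment> \<open>\<open>K\<close> bounds matrix multiplication; the radius c / (2K) lets the
    perturbation consume at most half of the lower bound.\<close>
  have "pos_def_ge (c / 2) T'" if T': "hermitian_matrix T'" "norm (T' - T) < c / (2 * K)" for T'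
    unfolding pos_def_ge_def
  proof (intro conjI allI)
    fix Y :: "complex^'n^'n"
    have "- inner Y ((T' - T) ** Y) \<le> norm Y * norm ((T' - T) ** Y)"
      by (smt (verit) Cauchy_Schwarz_ineq2)
    also have "\<dots> \<le> norm Y * (norm (T' - T) * norm Y * K)" by (intro mult_left_mono K) auto
    also have "\<dots> = (norm Y)\<^sup>2 * (norm (T' - T) * K)" by (simp add: power2_eq_square)
    also have "\<dots> \<le> (norm Y)\<^sup>2 * (c / 2)"
      using T'(2) K(1) by (intro mult_left_mono) (auto simp: field_simps)
    finally have "- inner Y ((T' - T) ** Y) \<le> c / 2 * (norm Y)\<^sup>2" by (simp add: mult.commute)
    moreover have "c * (norm Y)\<^sup>2 \<le> inner Y (T ** Y)" using T unfolding pos_def_ge_def by blast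
    ultimately show "c / 2 * (norm Y)\<^sup>2 \<le> inner Y (T' ** Y)"
      by (simp add: matrix_mult.diff_left inner_diff_right)
  qed (rule T')
  then show thesis using that[of "c / (2 * K)"] c K by simp
qed

lemma pos_sqrt_exists:
  fixes H :: "complex^'n^'n"
  assumes H: "pos_def_ge c H" "c > 0" "b \<longrightarrow> mat_cnj H = H"
  obtains T where "pos_def_ge (sqrt c) T" "T ** T = H" "b \<longrightarrow> mat_cnj T = T"
proof -
  have "hermitian_matrix H" using H by (simp add: pos_def_ge_def)
  then obtain U d where U: "unitary_matrix U" "b \<longrightarrow> mat_cnj U = U"
      and d: "adj U ** H ** U = diagonal_matrix (\<lambda>i. complex_of_real (d i))"
    using spectral_theorem_block[of H "\<lambda>_. 0" b] H(3) by (auto simp: block_diagonal_def)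
  have dc: "c \<le> d i" for i
    using pos_def_ge_unitary_conj[OF H(1) U(1)] by (simp add: d pos_def_ge_diagonal_matrix_iff)
  define D where "D = diagonal_matrix (\<lambda>i. complex_of_real (sqrt (d i)))"
  define T where "T = U ** D ** adj U"
  have "unitary_matrix (adj U)" using U(1) by (simp add: unitary_matrix_def)
  moreover have "pos_def_ge (sqrt c) D"
    unfolding D_def pos_def_ge_diagonal_matrix_iff using dc by simp
  ultimately have "pos_def_ge (sqrt c) T"
    unfolding T_def using pos_def_ge_unitary_conj[of "sqrt c" D "adj U"] by simp
  moreover have "T ** T = H"
  proof -
    have "d i \<ge> 0" for i using dc[of i] H(2) by simp
    then have DD: "D ** D = adj U ** H ** U"
      unfolding D_def diagonal_matrix_mult_diagonal_matrix d by simp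
    have "T ** T = U ** (D ** D) ** adj U"
      by (simp add: T_def matrix_mul_assoc unitary_matrixD[OF U(1)])
    also have "\<dots> = H"
      unfolding DD by (simp add: matrix_mul_assoc unitary_matrixD[OF U(1)])
    finally show ?thesis .
  qed
  moreover have "b \<longrightarrow> mat_cnj T = T"
    using U(2) unfolding T_def D_def by (simp add: mat_cnj_mult mat_cnj_adj mat_cnj_diagonal_matrix)
  ultimately show thesis by (rule that)
qed

text \<open>The difference solves the homogeneous equation S(S - T) + (S - T)T = 0.\<close>

lemma pos_sqrt_unique:
  fixes S T :: "complex^'n^'n"
  assumes "pos_def_ge a S" "a > 0" "pos_def_ge c T" "c > 0" "S ** S = T ** T"
  shows "S = T"
proof -
  have "S - T = 0"
  proof (rule Sylvester_eq_0)
    show "pos_def_ge (min a c) S" "pos_def_ge (min a c) T"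
      using assms by (auto intro: pos_def_ge_mono)
    show "S ** (S - T) + (S - T) ** T = 0"
      using assms(5) by (simp add: mat_algebra_simps)
  qed (use assms in auto)
  then show ?thesis by simp
qed

text \<open>If \<open>X\<close> commutes with the coefficient and the right-hand side, its
  commutator with the solution solves the homogeneous equation and so vanishes.\<close>

lemma Sylvester_commute:
  fixes T S K X :: "complex^'n^'n"
  assumes "pos_def_ge c T" "c > 0" "T ** S + S ** T = K" "X ** T = T ** X" "X ** K = K ** X"
  shows "X ** S = S ** X"
proof -
  have "X ** S - S ** X = 0"
  proof (rule Sylvester_eq_0)
    have "T ** (X ** S - S ** X) + (X ** S - S ** X) ** T
        = (T ** X) ** S - T ** S ** X + (X ** S ** T - S ** (X ** T))"
      by (simp add: mat_algebra_simps)
    also have "\<dots> = X ** T ** S - T ** S ** X + (X ** S ** T - S ** T ** X)"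
      by (simp add: assms(4)[symmetric] matrix_mul_assoc) (simp add: assms(4) flip: matrix_mul_assoc)
    also have "\<dots> = X ** (T ** S + S ** T) - (T ** S + S ** T) ** X"
      by (simp add: mat_algebra_simps)
    finally show "T ** (X ** S - S ** X) + (X ** S - S ** X) ** T = 0"
      unfolding assms(3) using assms(5) by simp
  qed (use assms in auto)
  then show ?thesis by simp
qed

text \<open>With C = XT - TX one has TC + CT = X T^2 - T^2 X = 0.\<close>

lemma pos_sqrt_commute:
  fixes T X :: "complex^'n^'n"
  assumes "pos_def_ge c T" "c > 0" "X ** (T ** T) = T ** T ** X"
  shows "X ** T = T ** X"
proof -
  have "X ** T - T ** X = 0"
  proof (rule Sylvester_eq_0)
    show "T ** (X ** T - T ** X) + (X ** T - T ** X) ** T = 0"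
      using assms(3) by (simp add: mat_algebra_simps)
  qed (use assms in auto)
  then show ?thesis by simp
qed

text \<open>\<open>S\<close> is the inverse square root of \<open>H\<close>. The last clause does
  the work of a functional calculus: since block structure is a commutation relation,
  \<open>S\<close> inherits it from \<open>H\<close>.\<close>

lemma smooth_pos_sqrt:
  fixes H :: "real \<Rightarrow> complex^'n^'n"
  assumes V: "open V" "0 \<in> V" and H: "smooth_on V H" "\<And>t. t \<in> V \<Longrightarrow> hermitian_matrix (H t)"
    "\<And>t. t \<in> V \<Longrightarrow> b \<longrightarrow> mat_cnj (H t) = H t"
    and c: "pos_def_ge c (H 0)" "c > 0"
  obtains W S a T where "open W" "0 \<in> W" "W \<subseteq> V" "smooth_on W S" "a > 0"
    "\<And>t. t \<in> W \<Longrightarrow> pos_def_ge a (T t)"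
    "\<And>t. t \<in> W \<Longrightarrow> T t ** T t = H t"
    "\<And>t. t \<in> W \<Longrightarrow> S t ** T t = mat 1"
    "\<And>t. t \<in> W \<Longrightarrow> T t ** S t = mat 1"
    "\<And>t. t \<in> W \<Longrightarrow> hermitian_matrix (S t)"
    "\<And>t. t \<in> W \<Longrightarrow> b \<longrightarrow> mat_cnj (S t) = S t"
    "\<And>t X. t \<in> W \<Longrightarrow> X ** H t = H t ** X \<Longrightarrow> X ** S t = S t ** X"
proof -
  obtain \<delta> where \<delta>: "\<delta> > 0" "\<And>T'. hermitian_matrix T' \<Longrightarrow> norm (T' - H 0) < \<delta> \<Longrightarrow> pos_def_ge (c / 2) T'"
    using pos_def_ge_perturb[OF c] by blast
  have "isCont H 0"
    using smooth_on_imp_continuous_on[OF H(1)] V by (simp add: continuous_on_eq_continuous_at)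
  then obtain e where e: "e > 0" "\<And>t. dist t 0 < e \<Longrightarrow> dist (H t) (H 0) < \<delta>"
    using \<delta>(1) unfolding continuous_at_eps_delta by (metis dist_commute)
  define W where "W = V \<inter> ball 0 e"
  have W: "open W" "0 \<in> W" "W \<subseteq> V" using V e(1) by (auto simp: W_def)
  have posH: "pos_def_ge (c / 2) (H t)" if "t \<in> W" for t
    using that \<delta>(2) H(2) e(2) by (auto simp: W_def dist_norm)
  have "\<exists>T. pos_def_ge (sqrt (c / 2)) T \<and> T ** T = H t \<and> (b \<longrightarrow> mat_cnj T = T)" if "t \<in> W" for t
    using pos_sqrt_exists[OF posH[OF that], of b] c(2) H(3) that W(3) by (metis half_gt_zero subsetD)
  then obtain T where T: "\<And>t. t \<in> W \<Longrightarrow> pos_def_ge (sqrt (c / 2)) (T t)" "\<And>t. t \<in> W \<Longrightarrow> T t ** T t = H t"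
      "\<And>t. t \<in> W \<Longrightarrow> b \<longrightarrow> mat_cnj (T t) = T t" by metis
  define a where "a = sqrt (c / 2)"
  have a: "a > 0" using c by (simp add: a_def)
  note T = T[folded a_def]
  have smT: "smooth_on W T"
    by (rule matrix_sqrt_smooth_on[OF W(1) a T(1,2) smooth_on_subset[OF H(1) W(3)]])
  \<comment> \<open>The inverse of \<open>T\<close> is characterised as the solution of TS + ST = 2,
    so that its smoothness and its commutation properties come from the Sylvester lemmas.\<close>
  have "\<exists>S. T t ** S + S ** T t = 2 *\<^sub>R mat 1" if "t \<in> W" for t
    using Sylvester_solvable[OF a T(1)[OF that] T(1)[OF that]] by metis
  then obtain S where S: "\<And>t. t \<in> W \<Longrightarrow> T t ** S t + S t ** T t = 2 *\<^sub>R mat 1" by metis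
  have smS: "smooth_on W S"
    unfolding smooth_on_def
  proof
    fix k
    have "Ck_on k W T" using smT by (simp add: smooth_on_def)
    then show "Ck_on k W S"
      using Sylvester_Ck_on[where T=T and Y=S, OF W(1) a T(1) S _ Ck_on_const] by blast
  qed
  have comm: "X ** S t = S t ** X" if "t \<in> W" "X ** T t = T t ** X" for t X
    by (rule Sylvester_commute[OF T(1)[OF that(1)] a S[OF that(1)] that(2)])
       (simp add: mat_algebra_simps)
  have TS: "T t ** S t = mat 1" if "t \<in> W" for t
  proof -
    have "2 *\<^sub>R (T t ** S t) = 2 *\<^sub>R mat 1"
      using S[OF that] comm[OF that refl] by (simp add: scaleR_2)
    then show ?thesis by simp
  qed
  then have ST: "S t ** T t = mat 1" if "t \<in> W" for t using that matrix_left_right_inverse by blast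
  \<comment> \<open>Uniqueness of the inverse transfers invariance under \<open>adj\<close> and
    \<open>mat_cnj\<close> from \<open>T\<close> to \<open>S\<close>.\<close>
  have inv: "R = S t" if t: "t \<in> W" and R: "R ** T t = mat 1" for R t
  proof -
    have "R = R ** (T t ** S t)" by (simp add: TS[OF t])
    also have "\<dots> = S t" unfolding matrix_mul_assoc R by simp
    finally show ?thesis .
  qed
  show thesis
  proof (rule that[OF W smS a T(1,2) ST TS])
    fix t assume t: "t \<in> W"
    have "adj (S t) ** T t = adj (T t ** S t)"
      using T(1)[OF t] by (simp add: adj_mult pos_def_ge_def hermitian_matrix_def)
    then show "hermitian_matrix (S t)"
      unfolding hermitian_matrix_def by (intro inv[OF t]) (simp add: TS[OF t])
    show "b \<longrightarrow> mat_cnj (S t) = S t"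
    proof
      assume b
      then have "mat_cnj (S t) ** T t = mat_cnj (S t ** T t)"
        using T(3)[OF t] by (simp add: mat_cnj_mult)
      then show "mat_cnj (S t) = S t" by (intro inv[OF t]) (simp add: ST[OF t])
    qed
    fix X assume "X ** H t = H t ** X"
    then have "X ** T t = T t ** X"
      using T(2)[OF t] by (intro pos_sqrt_commute[OF T(1)[OF t] a]) simp
    then show "X ** S t = S t ** X" by (rule comm[OF t])
  qed
qed

section \<open>Splitting of blocks\<close>

text \<open>The sign \<open>J\<close> of \<open>B - c\<close> commutes with \<open>B\<close>, and \<open>1 + J J(0)\<close> intertwines \<open>J\<close> with \<open>J(0)\<close>;
  the unitary part of the latter conjugates \<open>B\<close> into the commutant of \<open>J(0)\<close>.\<close>

lemma refine_blocks:
  fixes B :: "real \<Rightarrow> complex^'n^'n"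
  assumes V: "open V" "0 \<in> V" and B: "smooth_on V B" and hB: "\<And>t. t \<in> V \<Longrightarrow> hermitian_matrix (B t)"
    and bB: "\<And>t. t \<in> V \<Longrightarrow> b \<longrightarrow> mat_cnj (B t) = B t" and pB: "\<And>t. t \<in> V \<Longrightarrow> block_diagonal p (B t)"
    and d: "B 0 = diagonal_matrix (\<lambda>i. complex_of_real (d i))" and c: "\<And>i. d i \<noteq> c"
  obtains W X where "open W" "0 \<in> W" "W \<subseteq> V" "smooth_on W X"
    "\<And>t. t \<in> W \<Longrightarrow> unitary_matrix (X t)" "\<And>t. t \<in> W \<Longrightarrow> b \<longrightarrow> mat_cnj (X t) = X t"
    "\<And>t. t \<in> W \<Longrightarrow> block_diagonal p (X t)"
    "\<And>t. t \<in> W \<Longrightarrow> block_diagonal (\<lambda>i. 2 * p i + (if d i < c then 0 else 1)) (adj (X t) ** B t ** X t)"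
proof -
  define P :: "complex^'n^'n" where "P = diagonal_matrix (\<lambda>i. of_nat (p i))"
  have block: "block_diagonal p M \<longleftrightarrow> P ** M = M ** P" for M
    unfolding block_diagonal_iff_commute P_def by metis
  define G where "G t = B t - c *\<^sub>R mat 1" for t
  define H where "H t = G t ** G t" for t
  have smG: "smooth_on V G"
    unfolding G_def[abs_def] by (intro smooth_on_diff B smooth_on_const)
  have smH: "smooth_on V H"
    unfolding H_def[abs_def] by (intro smooth_on_matrix_mult smG)
  have hG: "adj (G t) = G t" if "t \<in> V" for t
    using hB[OF that] by (simp add: G_def adj_diff adj_scaleR hermitian_matrix_def)
  have bG: "b \<longrightarrow> mat_cnj (G t) = G t" if "t \<in> V" for t
    using bB[OF that] by (simp add: G_def mat_cnj_diff mat_cnj_scaleR)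
  have hH: "hermitian_matrix (H t)" if "t \<in> V" for t
    using hG[OF that] by (simp add: H_def hermitian_matrix_def adj_mult)
  have bH: "b \<longrightarrow> mat_cnj (H t) = H t" if "t \<in> V" for t
    using bG[OF that] by (simp add: H_def mat_cnj_mult)
  have G0: "G 0 = diagonal_matrix (\<lambda>i. complex_of_real (d i - c))"
    by (auto simp: G_def d vec_eq_iff diagonal_matrix_def mat_def scaleR_conv_of_real[where 'a=complex])
  \<comment> \<open>The distance from \<open>c\<close> to the spectrum of \<open>B 0\<close>; its
    square bounds \<open>H 0\<close> from below.\<close>
  define m where "m = Min (range (\<lambda>i. \<bar>d i - c\<bar>))"
  have m0: "m > 0" unfolding m_def using c by (subst Min_gr_iff) auto
  have m: "m \<le> \<bar>d i - c\<bar>" for i unfolding m_def by (rule Min_le) auto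
  \<comment> \<open>The explicit absolute value of \<open>G 0\<close> and its inverse
    \<open>S0\<close>. Uniqueness of the positive root identifies them with \<open>T 0\<close> and
    \<open>S 0\<close>, so \<open>J 0\<close> is the diagonal matrix of the signs of
    \<open>d i - c\<close>.\<close>
  define T0 :: "complex^'n^'n" where "T0 = diagonal_matrix (\<lambda>i. complex_of_real \<bar>d i - c\<bar>)"
  define S0 :: "complex^'n^'n" where "S0 = diagonal_matrix (\<lambda>i. complex_of_real (1 / \<bar>d i - c\<bar>))"
  have T0: "pos_def_ge m T0" unfolding T0_def pos_def_ge_diagonal_matrix_iff using m by blast
  have T0T0: "T0 ** T0 = H 0"
    unfolding T0_def H_def G0 diagonal_matrix_mult_diagonal_matrix by simp
  have T0S0: "T0 ** S0 = mat 1"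
    unfolding T0_def S0_def diagonal_matrix_mult_diagonal_matrix using c
    by (simp add: diagonal_matrix_1)
  have posH: "pos_def_ge (m * m) (H 0)"
    unfolding H_def G0 diagonal_matrix_mult_diagonal_matrix pos_def_ge_diagonal_matrix_iff
  proof
    fix i
    show "m * m \<le> (d i - c) * (d i - c)" using mult_mono[OF m[of i] m[of i]] m0 by simp
  qed
  have mm: "m * m > 0" using m0 by simp
  obtain W1 T S a where W1: "open W1" "0 \<in> W1" "W1 \<subseteq> V" and smS: "smooth_on W1 S" and a: "a > 0"
    and T: "\<And>t. t \<in> W1 \<Longrightarrow> pos_def_ge a (T t)" "\<And>t. t \<in> W1 \<Longrightarrow> T t ** T t = H t"
    and ST: "\<And>t. t \<in> W1 \<Longrightarrow> S t ** T t = mat 1"  "\<And>t. t \<in> W1 \<Longrightarrow> T t ** S t = mat 1"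
    and hS: "\<And>t. t \<in> W1 \<Longrightarrow> hermitian_matrix (S t)" and bS: "\<And>t. t \<in> W1 \<Longrightarrow> b \<longrightarrow> mat_cnj (S t) = S t"
    and commS: "\<And>t X. t \<in> W1 \<Longrightarrow> X ** H t = H t ** X \<Longrightarrow> X ** S t = S t ** X"
    using smooth_pos_sqrt[OF V smH hH bH posH mm] by blast
  define J where "J t = G t ** S t" for t
  have smJ: "smooth_on W1 J"
    unfolding J_def[abs_def] by (intro smooth_on_matrix_mult smooth_on_subset[OF smG W1(3)] smS)
  have commJ: "Y ** J t = J t ** Y" if "t \<in> W1" "Y ** B t = B t ** Y" for t Y
  proof -
    have "Y ** G t = G t ** Y" using that(2) by (simp add: G_def mat_algebra_simps)
    moreover from this have "Y ** S t = S t ** Y"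
      unfolding H_def by (intro commS that(1)) (simp add: H_def commute_mult)
    ultimately show ?thesis unfolding J_def by (rule commute_mult)
  qed
  have GS: "G t ** S t = S t ** G t" if "t \<in> W1" for t
    by (rule commS[OF that]) (simp add: H_def matrix_mul_assoc)
  have JJ: "J t ** J t = mat 1" if t: "t \<in> W1" for t
  proof -
    have "J t ** J t = G t ** (S t ** G t) ** S t" by (simp add: J_def matrix_mul_assoc)
    also have "\<dots> = H t ** S t ** S t" by (simp add: GS[OF t, symmetric] H_def matrix_mul_assoc)
    also have "\<dots> = T t ** (T t ** S t) ** S t" by (simp add: T(2)[OF t, symmetric] matrix_mul_assoc)
    finally show ?thesis using ST(2)[OF t] by simp
  qed
  have hJ: "adj (J t) = J t" if t: "t \<in> W1" for t
    using hS[OF t] hG[of t] GS[OF t] t W1(3) by (auto simp: J_def adj_mult hermitian_matrix_def)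
  have bJ: "b \<longrightarrow> mat_cnj (J t) = J t" if t: "t \<in> W1" for t
    using bS[OF t] bG[of t] t W1(3) by (auto simp: J_def mat_cnj_mult)
  have pJ: "block_diagonal p (J t)" if t: "t \<in> W1" for t
    unfolding block by (rule commJ[OF t]) (use pB[of t] t W1(3) block in auto)
  define J0 where "J0 = J 0"
  define sg where "sg i = (d i - c) * (1 / \<bar>d i - c\<bar>)" for i
  have J0: "J0 = diagonal_matrix (\<lambda>i. complex_of_real (sg i))"
  proof -
    have "T 0 = T0"
      by (rule pos_sqrt_unique[OF T(1)[OF W1(2)] a T0 m0]) (simp add: T0T0 T(2)[OF W1(2)])
    have "S 0 = S 0 ** (T 0 ** S0)" unfolding \<open>T 0 = T0\<close> T0S0 by simp
    also have "\<dots> = S0" unfolding matrix_mul_assoc ST(1)[OF W1(2)] by simp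
    finally have "S 0 = S0" .
    then show ?thesis
      unfolding J0_def J_def G0 S0_def sg_def by (simp only: diagonal_matrix_mult_diagonal_matrix)
  qed
  have J0J0: "J0 ** J0 = mat 1" unfolding J0_def by (rule JJ[OF W1(2)])
  define W0 where "W0 t = mat 1 + J t ** J0" for t
  \<comment> \<open>The factor 1/4 normalises \<open>H2 0\<close> to the identity, since
    \<open>W0 0\<close> is twice the identity.\<close>
  define H2 where "H2 t = (1/4) *\<^sub>R (adj (W0 t) ** W0 t)" for t
  have smW0: "smooth_on W1 W0"
    unfolding W0_def[abs_def] by (intro smooth_on_add smooth_on_const smooth_on_matrix_mult smJ)
  have smH2: "smooth_on W1 H2"
    unfolding H2_def[abs_def] by (intro smooth_on_scaleR smooth_on_matrix_mult smooth_on_adj smW0)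
  have hH2: "hermitian_matrix (H2 t)" for t
    by (simp add: H2_def hermitian_matrix_def adj_scaleR adj_mult)
  have bW0: "b \<longrightarrow> mat_cnj (W0 t) = W0 t" if "t \<in> W1" for t
    using bJ[OF that] bJ[OF W1(2)] by (simp add: W0_def J0_def mat_cnj_add mat_cnj_mult)
  have bH2: "b \<longrightarrow> mat_cnj (H2 t) = H2 t" if "t \<in> W1" for t
    using bW0[OF that] by (simp add: H2_def mat_cnj_scaleR mat_cnj_mult mat_cnj_adj)
  have "W0 0 = 2 *\<^sub>R mat 1" unfolding W0_def using J0J0 by (simp add: J0_def scaleR_2)
  then have "H2 0 = mat 1" by (simp add: H2_def adj_scaleR mat_algebra_simps)
  also have "mat 1 = diagonal_matrix (\<lambda>i. complex_of_real 1)" by (simp add: diagonal_matrix_1)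
  finally have posH2: "pos_def_ge 1 (H2 0)" by (simp only: pos_def_ge_diagonal_matrix_iff) simp
  obtain W2 T2 S2 a2 where W2: "open W2" "0 \<in> W2" "W2 \<subseteq> W1" and smS2: "smooth_on W2 S2" and "a2 > 0"
    and "\<And>t. t \<in> W2 \<Longrightarrow> pos_def_ge a2 (T2 t)" and T2: "\<And>t. t \<in> W2 \<Longrightarrow> T2 t ** T2 t = H2 t"
    and ST2: "\<And>t. t \<in> W2 \<Longrightarrow> S2 t ** T2 t = mat 1"  "\<And>t. t \<in> W2 \<Longrightarrow> T2 t ** S2 t = mat 1"
    and hS2: "\<And>t. t \<in> W2 \<Longrightarrow> hermitian_matrix (S2 t)" and bS2: "\<And>t. t \<in> W2 \<Longrightarrow> b \<longrightarrow> mat_cnj (S2 t) = S2 t"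
    and commS2: "\<And>t X. t \<in> W2 \<Longrightarrow> X ** H2 t = H2 t ** X \<Longrightarrow> X ** S2 t = S2 t ** X"
    using smooth_pos_sqrt[OF W1(1,2) smH2 hH2 bH2 posH2 zero_less_one] by blast
  \<comment> \<open>The unitary factor in the polar decomposition of \<open>W0\<close>; the 1/2
    matches the 1/4 in \<open>H2\<close>.\<close>
  define X where "X t = (1/2) *\<^sub>R (W0 t ** S2 t)" for t
  show thesis
  proof (rule that[of W2 X])
    show "open W2" "0 \<in> W2" "W2 \<subseteq> V" using W2 W1 by auto
    show "smooth_on W2 X"
      unfolding X_def[abs_def]
      by (intro smooth_on_scaleR smooth_on_matrix_mult smooth_on_subset[OF smW0 W2(3)] smS2)
    fix t assume t: "t \<in> W2"
    then have t1: "t \<in> W1" using W2 by auto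
    have pW0: "block_diagonal p (W0 t)"
      unfolding W0_def J0_def by (intro block_diagonal_add block_diagonal_mat block_diagonal_mult pJ t1 W1)
    have "block_diagonal p (H2 t)"
      unfolding H2_def by (intro block_diagonal_scaleR block_diagonal_mult block_diagonal_adj pW0)
    then have "block_diagonal p (S2 t)" unfolding block by (rule commS2[OF t])
    with pW0 show pX: "block_diagonal p (X t)"
      unfolding X_def by (intro block_diagonal_scaleR block_diagonal_mult)
    show "b \<longrightarrow> mat_cnj (X t) = X t"
      using bW0[OF t1] bS2[OF t] by (simp add: X_def mat_cnj_scaleR mat_cnj_mult)
    have adjS2: "adj (S2 t) = S2 t" using hS2[OF t] by (simp add: hermitian_matrix_def)
    have "adj (X t) ** X t = S2 t ** H2 t ** S2 t"
      by (simp add: X_def H2_def adj_scaleR adj_mult adjS2 mat_algebra_simps)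
    also have "\<dots> = (S2 t ** T2 t) ** (T2 t ** S2 t)"
      by (simp add: T2[OF t, symmetric] matrix_mul_assoc)
    finally show "unitary_matrix (X t)"
      by (intro unitary_matrixI) (simp add: ST2[OF t])
    have adjW0: "adj (W0 t) = mat 1 + J0 ** J t"
      using hJ[OF t1] hJ[OF W1(2)] by (simp add: W0_def J0_def adj_add adj_mult)
    have e1: "Y ** J0 ** J0 = Y" for Y by (simp add: J0J0 flip: matrix_mul_assoc)
    have e2: "Y ** J t ** J t = Y" for Y by (simp add: JJ[OF t1] flip: matrix_mul_assoc)
    \<comment> \<open>The intertwining must survive multiplication by \<open>S2\<close>, so
      \<open>J0\<close> has to commute with \<open>adj (W0 t) ** W0 t\<close>. Both products of
      \<open>J0\<close> with a factor equal the sum \<open>J0 + J t\<close>, which can be moved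
      across.\<close>
    have "J0 ** adj (W0 t) = J0 + J t" "W0 t ** J0 = J0 + J t"
      unfolding adjW0 unfolding W0_def by (simp_all add: mat_algebra_simps e1 J0J0)
    moreover have "(J0 + J t) ** W0 t = adj (W0 t) ** (J0 + J t)"
      unfolding adjW0 unfolding W0_def by (simp add: mat_algebra_simps e2 JJ[OF t1] add_ac)
    ultimately have "J0 ** H2 t = H2 t ** J0"
      unfolding H2_def
      by (simp add: matrix_mult.scaleR_left matrix_mult.scaleR_right)
         (metis matrix_mul_assoc)
    then have J0S2: "J0 ** S2 t = S2 t ** J0" by (rule commS2[OF t])
    have "J t ** W0 t = W0 t ** J0"
      by (simp add: W0_def mat_algebra_simps e1 JJ[OF t1] add_ac)
    then have JX: "J t ** X t = X t ** J0"
      by (simp add: X_def mat_algebra_simps) (simp add: J0S2 flip: matrix_mul_assoc)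
    have XJ: "adj (X t) ** J t = J0 ** adj (X t)"
      using arg_cong[OF JX, of adj] hJ[OF t1] hJ[OF W1(2)] by (simp add: adj_mult J0_def)
    define N where "N = adj (X t) ** B t ** X t"
    have "N ** J0 = adj (X t) ** B t ** (X t ** J0)" by (simp add: N_def matrix_mul_assoc)
    also have "\<dots> = adj (X t) ** (B t ** J t) ** X t" by (simp add: JX[symmetric] matrix_mul_assoc)
    also have "B t ** J t = J t ** B t" by (rule commJ[OF t1 refl])
    also have "adj (X t) ** (J t ** B t) ** X t = J0 ** N"
      by (simp add: N_def matrix_mul_assoc XJ)
    finally have comm: "N ** J0 = J0 ** N" .
    have e: "N $ i $ j * of_real (sg j) = of_real (sg i) * N $ i $ j" for i j
      using arg_cong[OF comm, of "\<lambda>M. M $ i $ j"] unfolding J0 diagonal_matrix_mult_nth .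
    have pN: "block_diagonal p N"
      unfolding N_def using pX pB[of t] t1 W1(3) by (intro block_diagonal_mult block_diagonal_adj) auto
    have sg: "sg i = (if d i < c then -1 else 1)" for i
      using c[of i] by (auto simp: sg_def divide_eq_eq)
    \<comment> \<open>The new label encodes the pair of old label and sign: a change of label is
      excluded by \<open>pN\<close>, a change of sign by commutation with \<open>J0\<close>.\<close>
    show "block_diagonal (\<lambda>i. 2 * p i + (if d i < c then 0 else 1)) (adj (X t) ** B t ** X t)"
      unfolding N_def[symmetric] block_diagonal_def
    proof (intro allI impI)
      fix i j assume ne: "2 * p i + (if d i < c then 0 else 1) \<noteq> 2 * p j + (if d j < c then 0 else (1::nat))"
      show "N $ i $ j = 0"
      proof (cases "p i = p j")
        case True
        then have "sg i \<noteq> sg j" using ne by (auto simp: sg split: if_splits)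
        then show ?thesis using e[of i j] by auto
      next
        case False
        then show ?thesis using pN by (simp add: block_diagonal_def)
      qed
    qed
  qed
qed

section \<open>Asymptotic diagonalization\<close>

text \<open>Cancelling a power of the parameter is possible only away from 0; this recovers the
  value at 0.\<close>

lemma continuous_on_eq_at_0:
  fixes f :: "real \<Rightarrow> 'a::t2_space"
  assumes "continuous_on (ball 0 r) f" "r > 0" "\<And>t. t \<in> ball 0 r \<Longrightarrow> t \<noteq> 0 \<Longrightarrow> f t = z"
  shows "f 0 = z"
proof -
  have "isCont f 0" using assms(1,2) by (simp add: continuous_on_eq_continuous_at)
  then have "(f \<longlongrightarrow> f 0) (at 0)" by (simp add: isCont_def)
  moreover have "\<forall>\<^sub>F t in at 0. f t = z"
    using eventually_at_in_open[of "ball 0 r" "0::real"] assms(2,3) by (auto elim!: eventually_mono)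
  then have "(f \<longlongrightarrow> z) (at 0)" by (rule tendsto_eventually)
  ultimately show ?thesis by (rule tendsto_unique[OF at_neq_bot])
qed

lemma is_O_eps_infinityI:
  fixes N :: "real \<Rightarrow> 'a::real_normed_vector"
  assumes "r > 0"
    and "\<And>k. \<exists>B. continuous_on (ball 0 r) B \<and> (\<forall>t\<in>ball 0 r. N t = t ^ k *\<^sub>R B t)"
  shows "is_O_eps_infinity N"
  unfolding is_O_eps_infinity_def
proof
  fix k
  obtain B where B: "continuous_on (ball 0 r) B" "\<forall>t\<in>ball 0 r. N t = t ^ k *\<^sub>R B t"
    using assms(2) by blast
  have "isCont B 0" using B(1) assms(1) by (simp add: continuous_on_eq_continuous_at)
  then obtain e where e: "e > 0" "\<And>t. dist t 0 < e \<Longrightarrow> dist (B t) (B 0) < 1"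
    unfolding continuous_at_eps_delta by (metis dist_commute zero_less_one)
  have "\<forall>\<^sub>F t in nhds 0. t \<in> ball 0 (min r e)"
    using assms(1) e(1) by (intro eventually_nhds_in_open) auto
  then have "\<forall>\<^sub>F t in nhds 0. norm (norm (N t)) \<le> (norm (B 0) + 1) * norm (t ^ k)"
  proof eventually_elim
    case (elim t)
    have "norm (B t) \<le> norm (B 0) + norm (B t - B 0)" by (rule norm_triangle_sub)
    also have "norm (B t - B 0) \<le> 1" using e(2)[of t] elim by (simp add: dist_norm)
    finally have "norm (B t) * norm (t ^ k) \<le> (norm (B 0) + 1) * norm (t ^ k)"
      by (intro mult_right_mono) auto
    then show ?case using B(2) elim by (simp add: mult.commute)
  qed
  then show "(\<lambda>t. norm (N t)) \<in> O[nhds 0](\<lambda>t. t ^ k)" by (rule bigoI)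
qed

text \<open>The relation is required only on a neighbourhood of 0. This covers both taking real
  parts and exchanging \<open>adj\<close> for \<open>matrix_inv\<close> where the family is known to
  be unitary.\<close>

lemma is_O_eps_infinity_bounded_linear:
  assumes "bounded_linear F" "is_O_eps_infinity R" "open V" "0 \<in> V" "\<And>t. t \<in> V \<Longrightarrow> R' t = F (R t)"
  shows "is_O_eps_infinity R'"
  unfolding is_O_eps_infinity_def
proof
  fix k
  obtain K where K: "\<And>x. norm (F x) \<le> norm x * K" using bounded_linear.bounded[OF assms(1)] by blast
  have "\<forall>\<^sub>F t in nhds 0. t \<in> V" using assms(3,4) by (rule eventually_nhds_in_open)
  then have "\<forall>\<^sub>F t in nhds 0. norm (norm (R' t)) \<le> K * norm (norm (R t))"
    by eventually_elim (use K assms(5) in \<open>simp add: mult.commute\<close>)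
  then have "(\<lambda>t. norm (R' t)) \<in> O[nhds 0](\<lambda>t. norm (R t))" by (rule bigoI)
  also have "(\<lambda>t. norm (R t)) \<in> O[nhds 0](\<lambda>t. t ^ k)" using assms(2) by (simp add: is_O_eps_infinity_def)
  finally show "(\<lambda>t. norm (R' t)) \<in> O[nhds 0](\<lambda>t. t ^ k)" .
qed

text \<open>Halving maps the new labels onto the old ones and identifies the labels of
  \<open>i\<close> and \<open>j\<close>, so it is not injective.\<close>

lemma card_range_refine:
  fixes p :: "'n::finite \<Rightarrow> nat"
  assumes "p i = p j" "q i \<noteq> q j" and q: "q = (\<lambda>i. 2 * p i + (if P i then 0 else 1))"
  shows "card (range p) < card (range q)"
proof -
  have eq: "range p = (\<lambda>x. x div 2) ` range q" by (auto simp: q image_image)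
  have "q i div 2 = q j div 2" using assms(1) by (simp add: q)
  then have "\<not> inj_on (\<lambda>x. x div 2) (range q)" using assms(2) by (auto simp: inj_on_def)
  then have "card ((\<lambda>x. x div 2) ` range q) \<noteq> card (range q)" 
    using eq_card_imp_inj_on[of "range q" "\<lambda>x. x div 2"] by auto
  then show ?thesis unfolding eq using card_image_le[of "range q" "\<lambda>x. x div 2"] by simp
qed

text \<open>The normalised trace of the block containing \<open>i\<close>. Real parts lose nothing
  for Hermitian matrices and make this a real-valued real-linear functional.\<close>

definition block_mean :: "('n \<Rightarrow> nat) \<Rightarrow> 'n \<Rightarrow> complex^'n^'n \<Rightarrow> real" where
  "block_mean p i M = (\<Sum>k | p k = p i. Re (M $ k $ k)) / card {k. p k = p i}"

lemma bounded_linear_block_mean: "bounded_linear (block_mean p i)"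
  by (rule linear_conv_bounded_linear[THEN iffD1])
     (simp add: linear_iff block_mean_def sum.distrib add_divide_distrib sum_distrib_left)

lemma bounded_linear_diagonal_matrix_block_mean:
  "bounded_linear (\<lambda>M. diagonal_matrix (\<lambda>i. complex_of_real (block_mean p i M)))"
  by (rule linear_conv_bounded_linear[THEN iffD1])
     (simp add: linear_iff vec_eq_iff diagonal_matrix_def
        linear_add[OF bounded_linear.linear[OF bounded_linear_block_mean]]
        linear_scale[OF bounded_linear.linear[OF bounded_linear_block_mean]] scaleR_conv_of_real[where 'a=complex])

lemma block_mean_of_block_scalar:
  assumes "\<And>k. p k = p i \<Longrightarrow> M $ k $ k = complex_of_real a"
  shows "block_mean p i M = a"
proof -
  have "(\<Sum>k | p k = p i. Re (M $ k $ k)) = (\<Sum>k | p k = p i. a)" using assms by (intro sum.cong) auto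
  moreover have "card {k. p k = p i} \<noteq> 0" by auto
  ultimately show ?thesis by (simp add: block_mean_def)
qed

lemma block_mean_cong: "p i = p j \<Longrightarrow> block_mean p i M = block_mean p j M"
  by (simp add: block_mean_def)

text \<open>Both cases of the theorem are instances, through \<open>b\<close>. The functions
  \<open>l j\<close> produced here are block means, hence equal for indices of one block.\<close>

lemma asymptotic_diagonalization:
  fixes A :: "real \<Rightarrow> complex^'n^'n"
  assumes S: "open S" "0 \<in> S" and A: "smooth_on S A" and hA: "\<And>t. t \<in> S \<Longrightarrow> hermitian_matrix (A t)"
    and bA: "\<And>t. t \<in> S \<Longrightarrow> b \<longrightarrow> mat_cnj (A t) = A t"
  obtains V U l where "open V" "0 \<in> V" "V \<subseteq> S" "smooth_on V U" "\<And>t. t \<in> V \<Longrightarrow> unitary_matrix (U t)"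
    "\<And>t. t \<in> V \<Longrightarrow> b \<longrightarrow> mat_cnj (U t) = U t" "\<And>j. smooth_on V (l j)"
    "is_O_eps_infinity (\<lambda>t. adj (U t) ** A t ** U t - diagonal_matrix (\<lambda>j. complex_of_real (l j t)))"
proof -
  define Q where "Q m \<longleftrightarrow> (\<exists>V U p. open V \<and> 0 \<in> V \<and> V \<subseteq> S \<and> smooth_on V U \<and> card (range p) = m \<and>
    (\<forall>t\<in>V. unitary_matrix (U t) \<and> (b \<longrightarrow> mat_cnj (U t) = U t) \<and> block_diagonal p (adj (U t) ** A t ** U t)))"
    for m :: nat
  have "Q 1"
    unfolding Q_def using S
    by (intro exI[of _ S] exI[of _ "\<lambda>_. mat 1"] exI[of _ "\<lambda>_. 0"])
       (auto simp: smooth_on_const unitary_matrix_1 block_diagonal_def)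
  have bound: "m \<le> CARD('n)" if "Q m" for m
    using that unfolding Q_def by (auto intro: card_image_le)
  define m where "m = (GREATEST m. Q m)"
  have "Q m" unfolding m_def using \<open>Q 1\<close> bound by (rule GreatestI_nat)
  have max: "m' \<le> m" if "Q m'" for m' unfolding m_def using that bound by (rule Greatest_le_nat)
  obtain V U p where V: "open V" "0 \<in> V" "V \<subseteq> S" and smU: "smooth_on V U" and m: "card (range p) = m"
    and U: "\<And>t. t \<in> V \<Longrightarrow> unitary_matrix (U t)" "\<And>t. t \<in> V \<Longrightarrow> b \<longrightarrow> mat_cnj (U t) = U t"
      "\<And>t. t \<in> V \<Longrightarrow> block_diagonal p (adj (U t) ** A t ** U t)"
    using \<open>Q m\<close> unfolding Q_def by blast
  obtain r where r: "r > 0" "ball 0 r \<subseteq> V" using V(1,2) open_contains_ball by blast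
  define M where "M t = adj (U t) ** A t ** U t" for t
  define L where "L t = diagonal_matrix (\<lambda>i. complex_of_real (block_mean p i (M t)))" for t
  define N where "N t = M t - L t" for t
  have smM: "smooth_on V M"
    unfolding M_def[abs_def]
    by (intro smooth_on_matrix_mult smooth_on_adj smU smooth_on_subset[OF A V(3)])
  have smN: "smooth_on V N"
    unfolding N_def[abs_def] L_def[abs_def]
    by (intro smooth_on_diff smM bounded_linear.smooth_on[OF bounded_linear_diagonal_matrix_block_mean])
  have hN: "adj (N t) = N t" if "t \<in> V" for t
  proof -
    have "adj (M t) = M t"
      using hermitian_conj[OF hA[of t], of "U t"] that V(3) unfolding M_def hermitian_matrix_def by blast
    moreover have "adj (L t) = L t"
      using hermitian_diagonal_matrix unfolding L_def hermitian_matrix_def .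
    ultimately show ?thesis by (simp add: N_def adj_diff)
  qed
  have bN: "b \<longrightarrow> mat_cnj (N t) = N t" if "t \<in> V" for t
    using bA[of t] U(2)[OF that] that V(3)
    by (auto simp: N_def M_def L_def mat_cnj_diff mat_cnj_mult mat_cnj_adj mat_cnj_diagonal_matrix)
  have pN: "N t $ i $ j = 0" if "t \<in> V" "p i \<noteq> p j" for t i j
    using U(3)[OF that(1)] that(2) by (auto simp: N_def M_def L_def block_diagonal_def diagonal_matrix_def)
  have mN: "block_mean p i (N t) = 0" for t i
  proof -
    have "block_mean p i (L t) = block_mean p i (M t)"
    proof (rule block_mean_of_block_scalar)
      fix k assume "p k = p i"
      then have "block_mean p k (M t) = block_mean p i (M t)" by (rule block_mean_cong)
      then show "L t $ k $ k = complex_of_real (block_mean p i (M t))"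
        by (simp add: L_def diagonal_matrix_def)
    qed
    then show ?thesis
      unfolding N_def by (simp add: linear_diff[OF bounded_linear.linear[OF bounded_linear_block_mean]])
  qed
  \<comment> \<open>This is where maximality enters: a nonzero leading coefficient at any order k
    would yield a finer partition.\<close>
  have key: "B 0 = 0" if smB: "smooth_on (ball 0 r) B" and NB: "\<And>t. t \<in> ball 0 r \<Longrightarrow> N t = t ^ k *\<^sub>R B t" for B k
  proof (rule ccontr)
    assume nz: "B 0 \<noteq> 0"
    \<comment> \<open>Linear relations satisfied by \<open>N\<close> pass to \<open>B\<close>: away
      from 0 by cancelling \<open>t ^ k\<close>, at 0 by continuity.\<close>
    have transfer: "F (B t) = 0" if F: "bounded_linear F" and FN: "\<And>t. t \<in> ball 0 r \<Longrightarrow> F (N t) = 0" and t: "t \<in> ball 0 r"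
      for F :: "complex^'n^'n \<Rightarrow> 'z::real_normed_vector" and t
    proof -
      have ne: "F (B t) = 0" if "t \<in> ball 0 r" "t \<noteq> 0" for t
      proof -
        have "t ^ k *\<^sub>R F (B t) = F (N t)"
          using NB[OF that(1)] by (simp add: linear_scale[OF bounded_linear.linear[OF F]])
        then show ?thesis using FN[OF that(1)] that(2) by simp
      qed
      have "continuous_on (ball 0 r) (\<lambda>t. F (B t))"
        by (rule bounded_linear.continuous_on[OF F smooth_on_imp_continuous_on[OF smB]])
      from continuous_on_eq_at_0[OF this r(1) ne] ne t show ?thesis by (cases "t = 0") auto
    qed
    have hB: "hermitian_matrix (B t)" if "t \<in> ball 0 r" for t
      using transfer[of "\<lambda>M. adj M - M" t] that hN r(2)
      by (auto simp: hermitian_matrix_def bounded_linear_sub bounded_linear_adj bounded_linear_ident subset_iff)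
    have bB: "b \<longrightarrow> mat_cnj (B t) = B t" if "t \<in> ball 0 r" for t
      using transfer[of "\<lambda>M. mat_cnj M - M" t] that bN r(2)
      by (auto simp: bounded_linear_sub bounded_linear_mat_cnj bounded_linear_ident subset_iff)
    have pB: "block_diagonal p (B t)" if "t \<in> ball 0 r" for t
      unfolding block_diagonal_def
    proof (intro allI impI)
      fix i j assume ne: "p i \<noteq> p j"
      have "bounded_linear (\<lambda>M :: complex^'n^'n. M $ i $ j)"
        by (intro bounded_linear_compose[OF bounded_linear_vec_nth bounded_linear_vec_nth])
      then show "B t $ i $ j = 0"
        by (rule transfer[OF _ _ that]) (use pN[OF _ ne] r(2) in blast)
    qed
    have mB: "block_mean p i (B 0) = 0" for i
      using transfer[OF bounded_linear_block_mean mN, of 0] r(1) by simp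
    have 0: "(0::real) \<in> ball 0 r" using r(1) by simp
    obtain U0 d where U0: "unitary_matrix U0" "block_diagonal p U0" "b \<longrightarrow> mat_cnj U0 = U0"
      and d: "adj U0 ** B 0 ** U0 = diagonal_matrix (\<lambda>i. complex_of_real (d i))"
      using spectral_theorem_block[OF hB[OF 0] pB[OF 0] bB[OF 0]] by blast
    \<comment> \<open>If the eigenvalues agreed within every block, \<open>B 0\<close> would be
      scalar on each block and so equal to its block means, which vanish.\<close>
    have "\<exists>i j. p i = p j \<and> d i < d j"
    proof (rule ccontr)
      assume *: "\<nexists>i j. p i = p j \<and> d i < d j"
      then have const: "d i = d j" if "p i = p j" for i j using that by (metis linorder_neqE)
      have "B 0 = U0 ** (adj U0 ** B 0 ** U0) ** adj U0"
        by (simp add: matrix_mul_assoc unitary_matrixD[OF U0(1)])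
      also have "\<dots> = diagonal_matrix (\<lambda>i. complex_of_real (d i)) ** U0 ** adj U0"
        unfolding d by (subst block_diagonal_commute[OF U0(2)]) (rule arg_cong[OF const], assumption, rule refl)
      finally have B0: "B 0 = diagonal_matrix (\<lambda>i. complex_of_real (d i))"
        by (simp add: unitary_matrixD[OF U0(1)])
      have "d i = block_mean p i (B 0)" for i
        by (rule block_mean_of_block_scalar[symmetric])
           (simp only: B0 diagonal_matrix_def vec_lambda_beta simp_thms if_True of_real_eq_iff, rule const)
      then have "d i = 0" for i unfolding mB .
      then have "B 0 = 0" unfolding B0 by (simp add: vec_eq_iff diagonal_matrix_def)
      with nz show False by simp
    qed
    then obtain i j where ij: "p i = p j" "d i < d j" by blast
    \<comment> \<open>The interval is infinite and the spectrum finite, so some \<open>c\<close>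
      separates two eigenvalues of one block and avoids all others.\<close>
    have "infinite ({d i<..<d j} - range d)" using ij(2) by (simp add: infinite_Ioo)
    then obtain c where c: "d i < c" "c < d j" "\<And>k. d k \<noteq> c"
      by (metis (no_types, lifting) Diff_iff ex_in_conv finite.emptyI greaterThanLessThan_iff rangeI)
    \<comment> \<open>A constant conjugation makes the family diagonal at 0, as
      \<open>refine_blocks\<close> requires, and preserves the \<open>p\<close>-blocks.\<close>
    define B' where "B' t = adj U0 ** B t ** U0" for t
    define q where "q = (\<lambda>i. 2 * p i + (if d i < c then 0 else 1))"
    have "smooth_on (ball 0 r) B'"
      unfolding B'_def[abs_def] by (intro smooth_on_matrix_mult smooth_on_const smB)
    moreover have "hermitian_matrix (B' t)" if "t \<in> ball 0 r" for t
      unfolding B'_def by (rule hermitian_conj[OF hB[OF that]])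
    moreover have "b \<longrightarrow> mat_cnj (B' t) = B' t" if "t \<in> ball 0 r" for t
      using bB[OF that] U0(3) by (simp add: B'_def mat_cnj_mult mat_cnj_adj)
    moreover have "block_diagonal p (B' t)" if "t \<in> ball 0 r" for t
      unfolding B'_def by (intro block_diagonal_mult block_diagonal_adj pB that U0)
    moreover have "B' 0 = diagonal_matrix (\<lambda>i. complex_of_real (d i))" by (simp add: B'_def d)
    ultimately obtain W X where W: "open W" "0 \<in> W" "W \<subseteq> ball 0 r" and smX: "smooth_on W X"
      and X: "\<And>t. t \<in> W \<Longrightarrow> unitary_matrix (X t)" "\<And>t. t \<in> W \<Longrightarrow> b \<longrightarrow> mat_cnj (X t) = X t"
        "\<And>t. t \<in> W \<Longrightarrow> block_diagonal p (X t)"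
        "\<And>t. t \<in> W \<Longrightarrow> block_diagonal q (adj (X t) ** B' t ** X t)"
      unfolding q_def using refine_blocks[OF open_ball 0, of B' b p d c] c(3) by blast
    define Y where "Y t = U0 ** X t" for t
    have WV: "W \<subseteq> V" using W(3) r(2) by blast
    have "Q (card (range q))"
      unfolding Q_def
    proof (intro exI[of _ W] exI[of _ "\<lambda>t. U t ** Y t"] exI[of _ q] conjI ballI refl)
      show "open W" "0 \<in> W" "W \<subseteq> S" using W WV V by auto
      show "smooth_on W (\<lambda>t. U t ** Y t)"
        unfolding Y_def by (intro smooth_on_matrix_mult smooth_on_const smX smooth_on_subset[OF smU WV])
      fix t assume t: "t \<in> W"
      then have tV: "t \<in> V" and tr: "t \<in> ball 0 r" using WV W(3) by auto
      have Y: "unitary_matrix (Y t)" unfolding Y_def by (rule unitary_matrix_mult[OF U0(1) X(1)[OF t]])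
      then show "unitary_matrix (U t ** Y t)" by (rule unitary_matrix_mult[OF U(1)[OF tV]])
      show "b \<longrightarrow> mat_cnj (U t ** Y t) = U t ** Y t"
        using U(2)[OF tV] U0(3) X(2)[OF t] by (simp add: Y_def mat_cnj_mult)
      have pY: "block_diagonal p (Y t)" unfolding Y_def by (intro block_diagonal_mult U0 X t)
      have "adj (U t ** Y t) ** A t ** (U t ** Y t) = adj (Y t) ** M t ** Y t"
        by (simp add: M_def adj_mult matrix_mul_assoc)
      also have "M t = t ^ k *\<^sub>R B t + L t" using NB[OF tr] by (simp add: N_def diff_eq_eq)
      also have "adj (Y t) ** (t ^ k *\<^sub>R B t + L t) ** Y t
          = t ^ k *\<^sub>R (adj (X t) ** B' t ** X t) + adj (Y t) ** (L t ** Y t)"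
        by (simp add: Y_def B'_def adj_mult mat_algebra_simps)
      \<comment> \<open>\<open>L t\<close> is scalar on the \<open>p\<close>-blocks, so conjugation
        by \<open>Y t\<close> leaves it diagonal. The scaled \<open>B'\<close> term is block
        diagonal for \<open>q\<close>, also at the parameter 0.\<close>
      also have "L t ** Y t = Y t ** L t"
        unfolding L_def
        by (rule block_diagonal_commute[OF pY, symmetric]) (simp only: of_real_eq_iff, rule block_mean_cong)
      also have "adj (Y t) ** (Y t ** L t) = L t"
        by (simp add: matrix_mul_assoc unitary_matrixD[OF Y])
      finally show "block_diagonal q (adj (U t ** Y t) ** A t ** (U t ** Y t))"
        using X(4)[OF t] unfolding L_def
        by (simp add: block_diagonal_add block_diagonal_scaleR block_diagonal_diagonal_matrix)
    qed
    then have "card (range q) \<le> card (range p)" unfolding m by (rule max)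
    moreover have "card (range p) < card (range q)"
      by (rule card_range_refine[OF ij(1) _ q_def]) (use ij c in \<open>simp add: q_def\<close>)
    ultimately show False by simp
  qed
  \<comment> \<open>The ball is the same for all k: \<open>key\<close> gives vanishing at 0 and
    Hadamard division supplies the next factor without loss of domain.\<close>
  have divide: "\<exists>B. smooth_on (ball 0 r) B \<and> (\<forall>t\<in>ball 0 r. N t = t ^ k *\<^sub>R B t)" for k
  proof (induction k)
    case 0
    show ?case using smooth_on_subset[OF smN r(2)] by auto
  next
    case (Suc k)
    then obtain B where B: "smooth_on (ball 0 r) B" "\<And>t. t \<in> ball 0 r \<Longrightarrow> N t = t ^ k *\<^sub>R B t" by blast
    obtain C where "smooth_on (ball 0 r) C" "\<And>t. t \<in> ball 0 r \<Longrightarrow> B t = t *\<^sub>R C t"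
      using Hadamard_division[OF B(1) key[OF B] r(1)] by blast
    with B(2) show ?case by (auto intro!: exI[of _ C] simp: mult.commute)
  qed
  have "is_O_eps_infinity N"
    using divide smooth_on_imp_continuous_on by (intro is_O_eps_infinityI[OF r(1)]) blast
  then show thesis
    using that[of V U "\<lambda>j t. block_mean p j (M t)"] V smU U
      bounded_linear.smooth_on[OF bounded_linear_block_mean smM]
    by (simp add: N_def[abs_def] M_def[abs_def] L_def[abs_def])
qed

section \<open>Passage between real and complex matrices\<close>

definition complex_matrix :: "real^'n^'m \<Rightarrow> complex^'n^'m" where
  "complex_matrix M = (\<chi> i j. complex_of_real (M $ i $ j))"

definition Re_matrix :: "complex^'n^'m \<Rightarrow> real^'n^'m" where
  "Re_matrix M = (\<chi> i j. Re (M $ i $ j))"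

lemma bounded_linear_complex_matrix: "bounded_linear complex_matrix"
  by (rule linear_conv_bounded_linear[THEN iffD1])
     (simp add: linear_iff vec_eq_iff complex_matrix_def scaleR_conv_of_real[where 'a=complex])

lemma bounded_linear_Re_matrix: "bounded_linear Re_matrix"
  by (rule linear_conv_bounded_linear[THEN iffD1]) (simp add: linear_iff vec_eq_iff Re_matrix_def)

lemma Re_matrix_complex_matrix: "Re_matrix (complex_matrix M) = M"
  by (simp add: vec_eq_iff Re_matrix_def complex_matrix_def)

lemma complex_matrix_Re_matrix: "mat_cnj M = M \<Longrightarrow> complex_matrix (Re_matrix M) = M"
  by (simp add: vec_eq_iff Re_matrix_def complex_matrix_def mat_cnj_nth complex_eq_iff)

lemma complex_matrix_mult: "complex_matrix (A ** B) = complex_matrix A ** complex_matrix B"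
  by (simp add: vec_eq_iff complex_matrix_def matrix_matrix_mult_def)

lemma complex_matrix_mat_1: "complex_matrix (mat 1) = mat 1"
  by (simp add: vec_eq_iff complex_matrix_def mat_def)

lemma adj_complex_matrix: "adj (complex_matrix A) = complex_matrix (transpose A)"
  by (simp add: vec_eq_iff complex_matrix_def adj_nth transpose_def)

lemma mat_cnj_complex_matrix: "mat_cnj (complex_matrix A) = complex_matrix A"
  by (simp add: vec_eq_iff complex_matrix_def mat_cnj_nth)

lemma complex_matrix_diff: "complex_matrix (A - B) = complex_matrix A - complex_matrix B"
  by (simp add: vec_eq_iff complex_matrix_def)

lemma complex_matrix_diagonal_matrix:
  "complex_matrix (diagonal_matrix d) = diagonal_matrix (\<lambda>i. complex_of_real (d i))"
  by (simp add: vec_eq_iff complex_matrix_def diagonal_matrix_def)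

theorem theorem2p1:
  shows "(\<forall>(S :: real set) (A :: real \<Rightarrow> real^'n^'n).
            open S \<and> 0 \<in> S \<and> C_infinity_on S A \<and> (\<forall>\<epsilon>\<in>S. symmetric_matrix (A \<epsilon>)) \<longrightarrow>
            (\<exists>(V :: real set) (U :: real \<Rightarrow> real^'n^'n) (l :: 'n \<Rightarrow> real \<Rightarrow> real).
               open V \<and> 0 \<in> V \<and> V \<subseteq> S \<and>
               C_infinity_on V U \<and> (\<forall>\<epsilon>\<in>V. orthogonal_matrix (U \<epsilon>)) \<and>
               (\<forall>j. C_infinity_on V (l j)) \<and>
               is_O_eps_infinity (\<lambda>\<epsilon>. matrix_inv (U \<epsilon>) ** A \<epsilon> ** U \<epsilon>
                                        - diagonal_matrix (\<lambda>j. l j \<epsilon>))))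
       \<and> (\<forall>(S :: real set) (A :: real \<Rightarrow> complex^'n^'n).
            open S \<and> 0 \<in> S \<and> C_infinity_on S A \<and> (\<forall>\<epsilon>\<in>S. hermitian_matrix (A \<epsilon>)) \<longrightarrow>
            (\<exists>(V :: real set) (U :: real \<Rightarrow> complex^'n^'n) (l :: 'n \<Rightarrow> real \<Rightarrow> real).
               open V \<and> 0 \<in> V \<and> V \<subseteq> S \<and>
               C_infinity_on V U \<and> (\<forall>\<epsilon>\<in>V. unitary_matrix (U \<epsilon>)) \<and>
               (\<forall>j. C_infinity_on V (l j)) \<and>
               is_O_eps_infinity (\<lambda>\<epsilon>. matrix_inv (U \<epsilon>) ** A \<epsilon> ** U \<epsilon>
                                        - diagonal_matrix (\<lambda>j. complex_of_real (l j \<epsilon>)))))"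
proof (intro conjI allI impI; elim conjE)
  fix S :: "real set" and A :: "real \<Rightarrow> real^'n^'n"
  assume S: "open S" "0 \<in> S" and A: "C_infinity_on S A" "\<forall>\<epsilon>\<in>S. symmetric_matrix (A \<epsilon>)"
  have smA: "smooth_on S (\<lambda>t. complex_matrix (A t))"
    using A(1) C_infinity_on_iff_smooth_on[OF S(1)]
    by (intro bounded_linear.smooth_on[OF bounded_linear_complex_matrix]) blast
  have hA: "hermitian_matrix (complex_matrix (A t))" if "t \<in> S" for t
    using A(2) that by (simp add: hermitian_matrix_def symmetric_matrix_def adj_complex_matrix)
  obtain V U l where V: "open V" "0 \<in> V" "V \<subseteq> S" and smU: "smooth_on V U"
    and uU: "\<And>t. t \<in> V \<Longrightarrow> unitary_matrix (U t)"
    and bU: "\<And>t. t \<in> V \<Longrightarrow> True \<longrightarrow> mat_cnj (U t) = U t" and sml: "\<And>j. smooth_on V (l j)"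
    and R: "is_O_eps_infinity (\<lambda>t. adj (U t) ** complex_matrix (A t) ** U t
              - diagonal_matrix (\<lambda>j. complex_of_real (l j t)))"
    using asymptotic_diagonalization[OF S smA hA, of True] mat_cnj_complex_matrix by blast
  \<comment> \<open>The flag makes \<open>U\<close> real on \<open>V\<close>, so taking real parts
    loses nothing there; as \<open>Re_matrix\<close> is bounded linear, smoothness and the flat
    remainder carry over.\<close>
  define Q where "Q t = Re_matrix (U t)" for t
  have QU: "complex_matrix (Q t) = U t" if "t \<in> V" for t
    using bU[OF that] by (simp add: Q_def complex_matrix_Re_matrix)
  have tQ: "transpose (Q t) ** Q t = mat 1" if t: "t \<in> V" for t
  proof -
    have "complex_matrix (transpose (Q t) ** Q t) = complex_matrix (mat 1)"
      using unitary_matrixD(1)[OF uU[OF t]]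
      by (simp add: complex_matrix_mult complex_matrix_mat_1 QU[OF t] flip: adj_complex_matrix)
    then show ?thesis by (metis Re_matrix_complex_matrix)
  qed
  then have Qt: "Q t ** transpose (Q t) = mat 1" if "t \<in> V" for t
    using that matrix_left_right_inverse by blast
  have "is_O_eps_infinity (\<lambda>t. matrix_inv (Q t) ** A t ** Q t - diagonal_matrix (\<lambda>j. l j t))"
  proof (rule is_O_eps_infinity_bounded_linear[OF bounded_linear_Re_matrix R V(1,2)])
    fix t assume t: "t \<in> V"
    have "adj (U t) ** complex_matrix (A t) ** U t - diagonal_matrix (\<lambda>j. complex_of_real (l j t))
        = complex_matrix (transpose (Q t) ** A t ** Q t - diagonal_matrix (\<lambda>j. l j t))"
      by (simp add: complex_matrix_diff complex_matrix_mult complex_matrix_diagonal_matrix QU[OF t]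
          flip: adj_complex_matrix)
    then show "matrix_inv (Q t) ** A t ** Q t - diagonal_matrix (\<lambda>j. l j t)
        = Re_matrix (adj (U t) ** complex_matrix (A t) ** U t - diagonal_matrix (\<lambda>j. complex_of_real (l j t)))"
      by (simp add: Re_matrix_complex_matrix matrix_inv_eq[OF Qt[OF t]])
  qed
  moreover have "smooth_on V Q"
    unfolding Q_def[abs_def] by (rule bounded_linear.smooth_on[OF bounded_linear_Re_matrix smU])
  ultimately show "\<exists>V U l. open V \<and> 0 \<in> V \<and> V \<subseteq> S \<and> C_infinity_on V U \<and>
      (\<forall>\<epsilon>\<in>V. orthogonal_matrix (U \<epsilon>)) \<and> (\<forall>j. C_infinity_on V (l j)) \<and>
      is_O_eps_infinity (\<lambda>\<epsilon>. matrix_inv (U \<epsilon>) ** A \<epsilon> ** U \<epsilon> - diagonal_matrix (\<lambda>j. l j \<epsilon>))"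
    using V sml tQ Qt unfolding orthogonal_matrix_def
    by (intro exI[of _ V] exI[of _ Q] exI[of _ l]) (simp add: C_infinity_on_iff_smooth_on)
next
  fix S :: "real set" and A :: "real \<Rightarrow> complex^'n^'n"
  assume S: "open S" "0 \<in> S" and A: "C_infinity_on S A" "\<forall>\<epsilon>\<in>S. hermitian_matrix (A \<epsilon>)"
  have smA: "smooth_on S A" using A(1) C_infinity_on_iff_smooth_on[OF S(1)] by blast
  have hA: "hermitian_matrix (A t)" if "t \<in> S" for t using A(2) that by blast
  obtain V U l where V: "open V" "0 \<in> V" "V \<subseteq> S" and smU: "smooth_on V U"
    and uU: "\<And>t. t \<in> V \<Longrightarrow> unitary_matrix (U t)"
    and "\<And>t. t \<in> V \<Longrightarrow> False \<longrightarrow> mat_cnj (U t) = U t" and sml: "\<And>j. smooth_on V (l j)"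
    and R: "is_O_eps_infinity (\<lambda>t. adj (U t) ** A t ** U t
              - diagonal_matrix (\<lambda>j. complex_of_real (l j t)))"
    using asymptotic_diagonalization[OF S smA hA, of False] by blast
  \<comment> \<open>Outside \<open>V\<close> nothing is known about \<open>U\<close>, and
    \<open>matrix_inv\<close> may differ from \<open>adj\<close>; only the values near 0
    matter.\<close>
  have "is_O_eps_infinity (\<lambda>t. matrix_inv (U t) ** A t ** U t
      - diagonal_matrix (\<lambda>j. complex_of_real (l j t)))"
    by (rule is_O_eps_infinity_bounded_linear[OF bounded_linear_ident R V(1,2)])
       (simp add: matrix_inv_eq[OF unitary_matrixD(2)[OF uU]])
  then show "\<exists>V U l. open V \<and> 0 \<in> V \<and> V \<subseteq> S \<and> C_infinity_on V U \<and>
      (\<forall>\<epsilon>\<in>V. unitary_matrix (U \<epsilon>)) \<and> (\<forall>j. C_infinity_on V (l j)) \<and>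
      is_O_eps_infinity (\<lambda>\<epsilon>. matrix_inv (U \<epsilon>) ** A \<epsilon> ** U \<epsilon>
        - diagonal_matrix (\<lambda>j. complex_of_real (l j \<epsilon>)))"
    using V sml smU uU
    by (intro exI[of _ V] exI[of _ U] exI[of _ l]) (simp add: C_infinity_on_iff_smooth_on)
qed

end
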